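(* In the setting of the context, assume (G1), (G2), (G3), and suppose (HJ) holds: there exist $\alpha_2\in(0,1)$ and $c_J\ge1$ such that for all $x\in X_0$, $0<r<\alpha_2R_0(x)$ and $y\in U(x,\alpha_2^2r)$, $\mu_x^{U(x,\alpha_2r)}(E)\le c_J\mu_y^{U(x,r)}(E)$ for every Borel $E\subseteq X\setminus U(x,r)$. Let $M:=(2c_D^2c^2c_1^2)\vee(3cc_2)$, let $k\in\mathbb N$ with $M\le M_0^k$ and $\alpha_0^k<1/4$, $\alpha_M:=\alpha_0^k$, and let $0<\alpha\le(\alpha_M\wedge\alpha_2)/4$. Then there exists $K\ge1$ such that for all $x\in X_0$ and $0<R<R_0(x)$, $$\sup_{U(x,\alpha R)}h\le K\inf_{U(x,\alpha R)}h\qquad\text{for all }h\in\mathcal H^+(U(x,R)).$$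
   Context: $(X,\rho)$ separable metric space, $X_0\subseteq X$ open; $\mathcal M(X)$ finite Borel measures (extended to universally measurable sets), $\|\mu\|=\mu(X)$, $\varepsilon_x$ Dirac measure. For every open $U\subseteq X$ and $x\in X$ a measure $\mu_x^U\in\mathcal M(X)$ is given such that for all open $U,V$ and $x$: $\mu_x^U(U)=0$, $\|\mu_x^U\|\le1$, $\mu_x^U=\varepsilon_x$ if $x\notin U$; $y\mapsto\mu_y^U(E)$ universally measurable for Borel $E$; $\mu_x^U=\int\mu_y^U\,d\mu_x^V(y)$ if $V\subseteq U$. For closed $A$, $\varepsilon_x^A:=\mu_x^{X\setminus A}$. For open $U$, $\mathcal H(U)$ is the set of universally measurable real $h$ on $X$ such that for every open $V$ with $\overline V\subseteq U$ and $x\in V$, $h$ is $\mu_x^V$-integrable with $\int h\,d\mu_x^V=h(x)$; $\mathcal H^+(U)$ its nonnegative elements. $\mathcal U(X_0)$: open $U$ with $\overline U\subseteq X_0$; $U(x,r)$ open ball; $R_0(x):=\sup\{r>0:\overline{U(x,r)}\subseteq X_0\}$. $G\colon X\times X\to(0,\infty]$ Borel, $G\mu(x)=\int G(x,y)d\mu(y)$, $\operatorname{cap}A:=\sup\{\|\mu\|:\mu\in\mathcal M(X),\mu(X\setminus A)=0,G\mu\le1\}$. (G1): there is $c_1\ge1$ such that for all $U\in\mathcal U(X_0)$, $x\in U$, $\delta>0$, closed $A\subseteq U$ there are a closed neighborhood $B\subseteq U$ of $A$ and a measure $\nu$ carried by $B$ with $\|\varepsilon_x^B\|-\delta<c_1\|\varepsilon_x^A\|$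 and $\|\varepsilon_y^A\|\le G\nu(y)\le c_1\|\varepsilon_y^B\|$ for all $y$. (G2): there are a strictly decreasing continuous $g\colon[0,\infty)\to(0,\infty]$ and $c,c_D,M_0\in[1,\infty)$, $\alpha_0\in(0,1)$ with $g(r/2)\le c_Dg(r)$, $M_0g(r)\le g(\alpha_0r)$ for all $r>0$ and $c^{-1}g\circ\rho\le G\le c\,g\circ\rho$. (G3): there is $c_2\ge1$ with $\operatorname{cap}U(x,r)\ge c_2^{-1}g(r)^{-1}$ for all $x\in X_0$, $0<r<R_0(x)$. *)

theory Defs
  imports "HOL-Analysis.Analysis" "HOL-Probability.Probability"
begin

definition fin_borel :: "'a::metric_space measure \<Rightarrow> bool" where
  "fin_borel M \<longleftrightarrow> sets M = sets borel \<and> finite_measure M"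

text \<open>Universally measurable sets and real functions: measurable w.r.t.
  the completion of every finite Borel measure.  Finite Borel measures are
  extended to universally measurable sets via their completion.\<close>
definition univ_meas_set :: "'a::metric_space set \<Rightarrow> bool" where
  "univ_meas_set A \<longleftrightarrow> (\<forall>M. fin_borel M \<longrightarrow> A \<in> sets (completion M))"

definition univ_meas_fun :: "('a::metric_space \<Rightarrow> real) \<Rightarrow> bool" where
  "univ_meas_fun h \<longleftrightarrow> (\<forall>M. fin_borel M \<longrightarrow> h \<in> borel_measurable (completion M))"

definition harmonic_kernel :: "('a::metric_space set \<Rightarrow> 'a \<Rightarrow> 'a measure) \<Rightarrow> bool" where
  "harmonic_kernel mu \<longleftrightarrow>
     (\<forall>U x. open U \<longrightarrow>
        fin_borel (mu U x) \<and> emeasure (mu U x) U = 0 \<and> measure (mu U x) UNIV \<le> 1 \<and>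
        (x \<notin> U \<longrightarrow> mu U x = return borel x)) \<and>
     (\<forall>U E. open U \<longrightarrow> E \<in> sets borel \<longrightarrow> univ_meas_fun (\<lambda>y. measure (mu U y) E)) \<and>
     (\<forall>U V x. open U \<longrightarrow> open V \<longrightarrow> V \<subseteq> U \<longrightarrow>
        (\<forall>E \<in> sets borel. measure (mu U x) E =
           integral\<^sup>L (completion (mu V x)) (\<lambda>y. measure (mu U y) E)))"

definition eps_bal :: "('a::metric_space set \<Rightarrow> 'a \<Rightarrow> 'a measure) \<Rightarrow> 'a set \<Rightarrow> 'a \<Rightarrow> 'a measure" where
  "eps_bal mu A x = mu (- A) x"

definition mnorm :: "'a measure \<Rightarrow> real" where
  "mnorm M = measure M (space M)"

definition Harm :: "('a::metric_space set \<Rightarrow> 'a \<Rightarrow> 'a measure) \<Rightarrow> 'a set \<Rightarrow> ('a \<Rightarrow> real) set" where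
  "Harm mu U = {h. univ_meas_fun h \<and>
     (\<forall>V x. open V \<longrightarrow> closure V \<subseteq> U \<longrightarrow> x \<in> V \<longrightarrow>
        integrable (completion (mu V x)) h \<and> integral\<^sup>L (completion (mu V x)) h = h x)}"

definition Harm_pos :: "('a::metric_space set \<Rightarrow> 'a \<Rightarrow> 'a measure) \<Rightarrow> 'a set \<Rightarrow> ('a \<Rightarrow> real) set" where
  "Harm_pos mu U = {h \<in> Harm mu U. \<forall>y. 0 \<le> h y}"

text \<open>\<U>(X_0) and R_0 (possibly +\<infinity>, hence ereal).\<close>
definition UX0 :: "'a::metric_space set \<Rightarrow> 'a set set" where
  "UX0 X0 = {U. open U \<and> closure U \<subseteq> X0}"

definition R0 :: "'a::metric_space set \<Rightarrow> 'a \<Rightarrow> ereal" where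
  "R0 X0 x = Sup {ereal r |r. r > 0 \<and> closure (ball x r) \<subseteq> X0}"

definition pot :: "('a \<Rightarrow> 'a \<Rightarrow> ennreal) \<Rightarrow> 'a measure \<Rightarrow> 'a \<Rightarrow> ennreal" where
  "pot G M x = (\<integral>\<^sup>+ y. G x y \<partial>M)"

definition cap :: "('a::metric_space \<Rightarrow> 'a \<Rightarrow> ennreal) \<Rightarrow> 'a set \<Rightarrow> ennreal" where
  "cap G A = (SUP M \<in> {M. fin_borel M \<and> emeasure M (- A) = 0 \<and> (\<forall>x. pot G M x \<le> 1)}.
                 emeasure M (space M))"

definition G1 :: "('a::metric_space set \<Rightarrow> 'a \<Rightarrow> 'a measure) \<Rightarrow> ('a \<Rightarrow> 'a \<Rightarrow> ennreal) \<Rightarrow> 'a set \<Rightarrow> real \<Rightarrow> bool" where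
  "G1 mu G X0 c1 \<longleftrightarrow> 1 \<le> c1 \<and>
     (\<forall>U \<in> UX0 X0. \<forall>x \<in> U. \<forall>\<delta>>0. \<forall>A. closed A \<longrightarrow> A \<subseteq> U \<longrightarrow>
        (\<exists>B \<nu>. closed B \<and> A \<subseteq> interior B \<and> B \<subseteq> U \<and> fin_borel \<nu> \<and> emeasure \<nu> (- B) = 0 \<and>
           mnorm (eps_bal mu B x) - \<delta> < c1 * mnorm (eps_bal mu A x) \<and>
           (\<forall>y. ennreal (mnorm (eps_bal mu A y)) \<le> pot G \<nu> y \<and>
                pot G \<nu> y \<le> ennreal (c1 * mnorm (eps_bal mu B y)))))"

definition G2 :: "('a::metric_space \<Rightarrow> 'a \<Rightarrow> ennreal) \<Rightarrow> (real \<Rightarrow> ennreal) \<Rightarrow> real \<Rightarrow> real \<Rightarrow> real \<Rightarrow> real \<Rightarrow> bool" where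
  "G2 G g c cD M0 alpha0 \<longleftrightarrow>
     (\<forall>r \<ge> 0. 0 < g r) \<and>
     (\<forall>r s. 0 \<le> r \<longrightarrow> r < s \<longrightarrow> g s < g r) \<and>
     continuous_on {0..} g \<and>
     1 \<le> c \<and> 1 \<le> cD \<and> 1 \<le> M0 \<and> 0 < alpha0 \<and> alpha0 < 1 \<and>
     (\<forall>r>0. g (r/2) \<le> ennreal cD * g r) \<and>
     (\<forall>r>0. ennreal M0 * g r \<le> g (alpha0 * r)) \<and>
     (\<forall>x y. g (dist x y) \<le> ennreal c * G x y \<and> G x y \<le> ennreal c * g (dist x y))"

definition G3 :: "('a::metric_space \<Rightarrow> 'a \<Rightarrow> ennreal) \<Rightarrow> (real \<Rightarrow> ennreal) \<Rightarrow> 'a set \<Rightarrow> real \<Rightarrow> bool" where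
  "G3 G g X0 c2 \<longleftrightarrow> 1 \<le> c2 \<and>
     (\<forall>x \<in> X0. \<forall>r. 0 < r \<longrightarrow> ereal r < R0 X0 x \<longrightarrow>
        inverse (ennreal c2 * g r) \<le> cap G (ball x r))"

definition HJ :: "('a::metric_space set \<Rightarrow> 'a \<Rightarrow> 'a measure) \<Rightarrow> 'a set \<Rightarrow> real \<Rightarrow> real \<Rightarrow> bool" where
  "HJ mu X0 alpha2 cJ \<longleftrightarrow> 0 < alpha2 \<and> alpha2 < 1 \<and> 1 \<le> cJ \<and>
     (\<forall>x \<in> X0. \<forall>r y E. 0 < r \<longrightarrow> ereal r < ereal alpha2 * R0 X0 x \<longrightarrow>
        y \<in> ball x (alpha2\<^sup>2 * r) \<longrightarrow> E \<in> sets borel \<longrightarrow> E \<subseteq> - ball x r \<longrightarrow>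
        measure (mu (ball x (alpha2 * r)) x) E \<le> cJ * measure (mu (ball x r) y) E)"

end

theory Submission
  imports Defs
begin

text \<open>The argument is of Bass--Levin type. By (G1) and (G2), a closed set \<open>A\<close> in
  \<open>ball x (\<alpha>\<^sub>M R / 2)\<close> is hit, before leaving \<open>ball x R\<close> and from any point of that smaller ball,
  with probability at least \<open>g(R) \<sigma>(A) / c\<^sup>2\<close> whenever \<open>G\<sigma> \<le> 1\<close>. Hence a nonnegative harmonic \<open>u\<close>
  with small value at one point \<open>z\<close> cannot be large on a set of large capacity. If \<open>u(y)\<close> is huge
  compared with \<open>u(z)\<close>, then by (G3) \<open>u\<close> is below \<open>\<kappa> u(y)\<close> on a closed set \<open>F\<close> near \<open>y\<close> which is hit
  with probability at least some fixed \<open>\<eta>\<close>; since (HJ) bounds the contribution of long jumps by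
  values of \<open>u\<close> on \<open>F\<close>, some point near \<open>y\<close> has a value larger by a fixed factor. Iterating with
  geometrically decreasing radii makes \<open>u\<close> unbounded in \<open>ball x (2 \<alpha> R)\<close>. To contradict this,
  \<open>u\<close> has to be bounded, so \<open>h\<close> is first replaced by the sweeping of \<open>min h n\<close> on a slightly smaller
  ball, and \<open>n\<close> tends to infinity at the end.\<close>

section \<open>Finite Borel measures and universal measurability\<close>

text \<open>Regularity by induction over the Borel sets. Approximating from inside and outside at
  once makes the claim symmetric under complements.\<close>

lemma finite_borel_closed_open_approx:
  fixes M :: "'a::metric_space measure"
  assumes M: "fin_borel M" and E: "E \<in> sets borel" and e: "0 < e"
  shows "\<exists>F W. closed F \<and> open W \<and> F \<subseteq> E \<and> E \<subseteq> W \<and> measure M (W - F) < e"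
proof -
  interpret finite_measure M using M by (simp add: fin_borel_def)
  have sets [simp]: "sets M = sets borel" using M by (simp add: fin_borel_def)
  have borel_closed_sets: "closed F \<Longrightarrow> F \<in> sets M" and borel_open_sets: "open W \<Longrightarrow> W \<in> sets M"
    for F W :: "'a set" by simp_all
  have "E \<in> sigma_sets UNIV {S. open S}" using E by (simp add: borel_def)
  then show ?thesis using e
  proof (induction arbitrary: e rule: sigma_sets.induct)
    case (Basic S)
    then have S: "open S" by simp
    show ?case
    \<comment> \<open>\<open>infdist\<close> to the empty set is 0 by convention, so for
      \<open>S = UNIV\<close> the sets \<open>F n\<close> below would be empty. Otherwise they are
      closed and exhaust the open set \<open>S\<close>.\<close>
    proof (cases "S = UNIV")
      case True
      then show ?thesis using Basic by (intro exI[of _ UNIV]) simp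
    next
      case False
      then have ne: "- S \<noteq> {}" by auto
      define F where "F n = {x. 1 / real (Suc n) \<le> infdist x (- S)}" for n
      have cl: "closed (F n)" for n
        unfolding F_def by (intro closed_Collect_le continuous_intros)
      have sub: "F n \<subseteq> S" for n
      proof
        fix x assume "x \<in> F n"
        then have "0 < infdist x (- S)"
          unfolding F_def by (smt (verit) mem_Collect_eq of_nat_0_less_iff zero_less_Suc zero_less_divide_1_iff)
        then show "x \<in> S" by (metis ComplI infdist_zero less_irrefl)
      qed
      have "incseq F"
      proof (rule incseq_SucI, rule subsetI)
        fix n x assume "x \<in> F n"
        moreover have "1 / real (Suc (Suc n)) \<le> 1 / real (Suc n)" by (simp add: frac_le)
        ultimately show "x \<in> F (Suc n)" unfolding F_def by (simp del: of_nat_Suc)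
      qed
      moreover have "(\<Union>n. F n) = S"
      proof
        show "S \<subseteq> (\<Union>n. F n)"
        proof
          fix x assume "x \<in> S"
          then have "infdist x (- S) \<noteq> 0"
            using in_closed_iff_infdist_zero[of "- S" x] ne S by (auto simp: closed_def)
          then have "0 < infdist x (- S)" using infdist_nonneg[of x "- S"] by linarith
          then obtain n where "inverse (real (Suc n)) < infdist x (- S)" using reals_Archimedean by blast
          then show "x \<in> (\<Union>n. F n)" by (auto simp: F_def inverse_eq_divide intro!: exI[of _ n])
        qed
      qed (use sub in auto)
      ultimately have "(\<lambda>n. measure M (F n)) \<longlonglongrightarrow> measure M S"
        using finite_Lim_measure_incseq[of F] cl by (force simp: image_subset_iff)
      then have "\<forall>\<^sub>F n in sequentially. measure M S - e < measure M (F n)"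
        using Basic.prems by (intro order_tendstoD) auto
      then obtain n where n: "measure M S - e < measure M (F n)"
        by (auto simp: eventually_sequentially)
      have "measure M (S - F n) < e"
        using n finite_measure_Diff[of S "F n"] sub[of n] cl[of n] S by simp
      then show ?thesis using cl S sub by blast
    qed
  next
    case Empty
    then show ?case by (intro exI[of _ "{}"]) simp
  next
    case (Compl a)
    obtain F W where "closed F" "open W" "F \<subseteq> a" "a \<subseteq> W" "measure M (W - F) < e"
      using Compl.IH[OF Compl.prems] by blast
    moreover have "- F - (- W) = W - F" by auto
    ultimately show ?case
      by (intro exI[of _ "- W"] exI[of _ "- F"]) (auto simp: open_Compl closed_Compl)
  next
    case (Union a)
    define d where "d n = e / 4 * (1/2) ^ n" for n :: nat
    have "0 < d n" for n using Union.prems by (simp add: d_def)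
    then have "\<forall>n. \<exists>F W. closed F \<and> open W \<and> F \<subseteq> a n \<and> a n \<subseteq> W \<and> measure M (W - F) < d n"
      using Union.IH by blast
    then obtain F W where FW: "\<And>n. closed (F n)" "\<And>n. open (W n)" "\<And>n. F n \<subseteq> a n"
      "\<And>n. a n \<subseteq> W n" "\<And>n. measure M (W n - F n) < d n" by metis
    have dsum: "d sums (e / 2)"
      unfolding d_def using sums_mult[OF geometric_sums[of "1/2 :: real"], of "e / 4"] by simp
    \<comment> \<open>The union of all \<open>F i\<close> need not be closed, so it is cut off at a
      finite stage. The errors \<open>d n\<close> use one half of \<open>e\<close>, the cut the
      other half.\<close>
    let ?F = "\<lambda>n. \<Union>i\<le>n. F i"
    have FS: "\<And>n. F n \<in> sets M" "\<And>n. W n \<in> sets M" "\<And>n. ?F n \<in> sets M"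
      using FW(1,2) by (auto intro!: borel_closed_sets closed_UN)
    have sm: "summable (\<lambda>n. measure M (W n - F n))"
      by (rule summable_comparison_test'[OF sums_summable[OF dsum], of 0]) (use FW(5) in \<open>auto intro: less_imp_le\<close>)
    have "measure M ((\<Union>n. W n) - (\<Union>n. F n)) \<le> measure M (\<Union>n. W n - F n)"
      using FS by (intro finite_measure_mono) auto
    also have "\<dots> \<le> (\<Sum>n. measure M (W n - F n))"
      using FS sm by (intro finite_measure_subadditive_countably) auto
    also have "\<dots> \<le> suminf d"
      using sm sums_summable[OF dsum] FW(5) by (intro suminf_le) (auto intro: less_imp_le)
    also have "\<dots> = e / 2" using dsum by (simp add: sums_iff)
    finally have A: "measure M ((\<Union>n. W n) - (\<Union>n. F n)) \<le> e / 2" .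
    have "incseq ?F" by (intro monoI UN_mono) auto
    then have "(\<lambda>n. measure M (?F n)) \<longlonglongrightarrow> measure M (\<Union>n. ?F n)"
      using finite_Lim_measure_incseq[of ?F] FS(3) by auto
    moreover have UF: "(\<Union>n. ?F n) = (\<Union>n. F n)" by auto
    ultimately have "\<forall>\<^sub>F n in sequentially. measure M (\<Union>n. F n) - e / 2 < measure M (?F n)"
      using Union.prems by (intro order_tendstoD) auto
    then obtain n where n: "measure M (\<Union>n. F n) - e / 2 < measure M (?F n)"
      by (auto simp: eventually_sequentially)
    have B: "measure M ((\<Union>n. F n) - ?F n) < e / 2"
      using n FS by (subst finite_measure_Diff) auto
    have "measure M ((\<Union>n. W n) - ?F n) \<le> measure M (((\<Union>n. W n) - (\<Union>n. F n)) \<union> ((\<Union>n. F n) - ?F n))"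
      using FS by (intro finite_measure_mono sets.Un sets.Diff sets.countable_UN) auto
    also have "\<dots> \<le> measure M ((\<Union>n. W n) - (\<Union>n. F n)) + measure M ((\<Union>n. F n) - ?F n)"
      using FS by (intro measure_subadditive sets.Diff sets.countable_UN) auto
    finally have "measure M ((\<Union>n. W n) - ?F n) < e" using A B by linarith
    moreover have "closed (?F n)" using FW(1) by (intro closed_UN) auto
    moreover have "open (\<Union>n. W n)" using FW(2) by auto
    moreover have "?F n \<subseteq> \<Union>(range a)" "\<Union>(range a) \<subseteq> (\<Union>n. W n)" using FW(3,4) by blast+
    ultimately show ?case by blast
  qed
qed

lemma space_fin_borel: "fin_borel M \<Longrightarrow> space M = UNIV"
  using sets_eq_imp_space_eq[of M borel] by (simp add: fin_borel_def)

text \<open>A set of the completion has the same mass as its Borel \<open>main_part\<close>, which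
  is regular. This supplies the closed sets for which (G1) is stated, starting from level sets that
  are only universally measurable.\<close>

lemma completion_closed_approx:
  fixes M :: "'a::metric_space measure"
  assumes M: "fin_borel M" and E: "E \<in> sets (completion M)" and e: "0 < e"
  shows "\<exists>F. closed F \<and> F \<subseteq> E \<and> measure (completion M) E < measure M F + e"
proof -
  interpret finite_measure M using M by (simp add: fin_borel_def)
  have sets: "sets M = sets borel" using M by (simp add: fin_borel_def)
  let ?E = "main_part M E"
  have mE: "?E \<in> sets M" "?E \<subseteq> E" using E main_part_null_part_Un[OF E] by (simp, blast)
  obtain F W where F: "closed F" "open W" "F \<subseteq> ?E" "?E \<subseteq> W" "measure M (W - F) < e"
    using finite_borel_closed_open_approx[OF M _ e] mE sets by metis
  have S: "F \<in> sets M" "W \<in> sets M" using F sets by auto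
  have "measure (completion M) E = measure M ?E" using E by (simp add: measure_def)
  also have "\<dots> \<le> measure M W" using F S by (intro finite_measure_mono) auto
  also have "\<dots> = measure M (W - F) + measure M F"
    using finite_measure_Diff[OF S(2,1)] F by auto
  finally show ?thesis using F mE by (intro exI[of _ F]) auto
qed

text \<open>Preimages under \<open>f\<close> and \<open>g\<close> differ by a subset of a null set,
  and the completion contains all such subsets.\<close>

lemma borel_measurable_completion_AE:
  fixes f g :: "'a \<Rightarrow> ennreal"
  assumes g: "g \<in> borel_measurable (completion M)" and ae: "AE x in completion M. f x = g x"
  shows "f \<in> borel_measurable (completion M)"
proof (rule measurableI)
  fix A :: "ennreal set" assume A: "A \<in> sets borel"
  show "f -` A \<inter> space (completion M) \<in> sets (completion M)"
  proof (rule completion.in_sets_AE[where A="g -` A \<inter> space (completion M)"])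
    show "AE x in completion M. (x \<in> g -` A \<inter> space (completion M)) = (x \<in> f -` A \<inter> space (completion M))"
      using ae by eventually_elim auto
    show "g -` A \<inter> space (completion M) \<in> sets (completion M)"
      using g A by (rule measurable_sets)
  qed auto
qed simp

text \<open>Turns a comparison of measures on subsets of \<open>D\<close>, as in (HJ), into one of
  integrals. An \<open>N\<close>-null set meets \<open>D\<close> in an \<open>M\<close>-null set, so
  \<open>f\<close> may be replaced by a Borel version under both integrals.\<close>

lemma nn_integral_le_of_measure_le:
  fixes f :: "'a::metric_space \<Rightarrow> ennreal"
  assumes M: "fin_borel M" and N: "fin_borel N" and D: "D \<in> sets borel" and C: "0 \<le> C"
    and f: "f \<in> borel_measurable (completion N)"
    and le: "\<And>E. E \<in> sets borel \<Longrightarrow> E \<subseteq> D \<Longrightarrow> measure M E \<le> C * measure N E"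
  shows "(\<integral>\<^sup>+x. f x * indicator D x \<partial>M) \<le> ennreal C * (\<integral>\<^sup>+x. f x \<partial>N)"
proof -
  interpret M: finite_measure M using M by (simp add: fin_borel_def)
  interpret N: finite_measure N using N by (simp add: fin_borel_def)
  have sM [measurable_cong]: "sets M = sets borel" and sN [measurable_cong]: "sets N = sets borel"
    using M N by (simp_all add: fin_borel_def)
  have spM: "space M = UNIV" using sM sets_eq_imp_space_eq[of M borel] by simp
  note [measurable] = D
  have le': "emeasure M E \<le> ennreal C * emeasure N E" if "E \<in> sets borel" "E \<subseteq> D" for E
    using le[OF that] C
    by (simp add: M.emeasure_eq_measure N.emeasure_eq_measure ennreal_mult[symmetric] ennreal_leI)
  obtain f' where f' [measurable]: "f' \<in> borel_measurable N" and ae: "AE x in N. f x = f' x"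
    using completion_ex_borel_measurable[OF f] by blast
  from ae obtain Z where Z: "Z \<in> null_sets N" "{x \<in> space N. f x \<noteq> f' x} \<subseteq> Z"
    by (auto simp: eventually_ae_filter)
  have spN: "space N = UNIV" using sN sets_eq_imp_space_eq[of N borel] by simp
  have "emeasure M (Z \<inter> D) \<le> ennreal C * emeasure N (Z \<inter> D)"
    using sets.Int[OF null_setsD2[OF Z(1)], of D] D sN by (intro le') simp_all
  also have "emeasure N (Z \<inter> D) = 0"
    by (rule emeasure_eq_0[OF null_setsD2[OF Z(1)] null_setsD1[OF Z(1)]]) simp
  finally have "Z \<inter> D \<in> null_sets M" using Z D sN sM by (auto simp: null_sets_def)
  then have "AE x in M. f x * indicator D x = f' x * indicator D x"
    by (rule AE_I') (use Z spN in \<open>auto split: split_indicator\<close>)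
  then have "(\<integral>\<^sup>+x. f x * indicator D x \<partial>M) = (\<integral>\<^sup>+x. f' x * indicator D x \<partial>M)"
    by (rule nn_integral_cong_AE)
  also have "\<dots> = (\<integral>\<^sup>+x. f' x \<partial>density M (indicator D))"
    by (subst nn_integral_density) (auto simp: mult.commute)
  also have "\<dots> \<le> (\<integral>\<^sup>+x. f' x \<partial>scale_measure (ennreal C) N)"
  proof (rule nn_integral_mono_measure)
    \<comment> \<open>For measures with equal space and sigma-algebra the order is setwise
      comparison, and the integral is monotone in that order.\<close>
    show "density M (indicator D) \<le> scale_measure (ennreal C) N"
    proof (rule less_eq_measure.intros(3))
      show "emeasure (density M (indicator D)) \<le> emeasure (scale_measure (ennreal C) N)"
      proof (rule le_funI)
        fix E
        show "emeasure (density M (indicator D)) E \<le> emeasure (scale_measure (ennreal C) N) E"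
        proof (cases "E \<in> sets M")
          case True
          then have "emeasure (density M (indicator D)) E = emeasure M (D \<inter> E)"
            using D sM by (subst emeasure_density) (auto simp flip: indicator_inter_arith)
          also have "\<dots> \<le> ennreal C * emeasure N (D \<inter> E)"
            using True sM by (intro le') auto
          also have "\<dots> \<le> ennreal C * emeasure N E"
            using True sM sN by (intro mult_left_mono emeasure_mono) auto
          finally show ?thesis by simp
        next
          case False
          then show ?thesis by (simp add: emeasure_notin_sets)
        qed
      qed
    qed (use spM spN sM sN in \<open>simp_all add: space_scale_measure\<close>)
  qed (use sM sN in simp)
  also have "\<dots> = ennreal C * (\<integral>\<^sup>+x. f' x \<partial>N)" by (rule nn_integral_scale_measure) fact
  also have "(\<integral>\<^sup>+x. f' x \<partial>N) = (\<integral>\<^sup>+x. f x \<partial>N)"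
    using ae by (intro nn_integral_cong_AE) (auto elim: eventually_mono)
  finally show ?thesis .
qed

section \<open>Sweeping\<close>

locale harmonic_kernel_space =
  fixes mu :: "'a::metric_space set \<Rightarrow> 'a \<Rightarrow> 'a measure"
  assumes kernel: "harmonic_kernel mu"
begin

section \<open>Exit kernels and their composition\<close>

context
  fixes U :: "'a set"
  assumes U: "open U"
begin

lemma fin_borel_mu: "fin_borel (mu U x)"
  and emeasure_mu_self: "emeasure (mu U x) U = 0"
  and mu_outside: "x \<notin> U \<Longrightarrow> mu U x = return borel x"
  and measure_mu_UNIV_le_1: "measure (mu U x) UNIV \<le> 1"
  and univ_meas_mu: "E \<in> sets borel \<Longrightarrow> univ_meas_fun (\<lambda>y. measure (mu U y) E)"
proof -
  note K = kernel[unfolded harmonic_kernel_def]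
  show "fin_borel (mu U x)" "emeasure (mu U x) U = 0" "measure (mu U x) UNIV \<le> 1"
    "x \<notin> U \<Longrightarrow> mu U x = return borel x" for x
    using conjunct1[OF K, rule_format, OF U, of x] by simp_all
  show "E \<in> sets borel \<Longrightarrow> univ_meas_fun (\<lambda>y. measure (mu U y) E)" for E
    using conjunct1[OF conjunct2[OF K], rule_format, OF U, of E] by simp
qed

lemma sets_mu: "sets (mu U x) = sets borel"
  and finite_measure_mu: "finite_measure (mu U x)"
  using fin_borel_mu by (simp_all add: fin_borel_def)

lemma space_mu: "space (mu U x) = UNIV"
  using sets_eq_imp_space_eq[OF sets_mu] by simp

lemma emeasure_mu: "emeasure (mu U x) E = ennreal (measure (mu U x) E)"
  by (rule finite_measure.emeasure_eq_measure[OF finite_measure_mu])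

lemma measure_mu_le_1: "measure (mu U x) E \<le> 1"
  using finite_measure.bounded_measure[OF finite_measure_mu, of x E] measure_mu_UNIV_le_1[of x]
  by (simp add: space_mu)

lemma AE_mu_notin: "AE y in mu U x. y \<notin> U"
  by (rule AE_I'[of U]) (auto simp: null_sets_def emeasure_mu_self U sets_mu)

lemma subprob_space_mu: "subprob_space (mu U x)"
  by (rule subprob_spaceI) (simp_all add: space_mu emeasure_mu measure_mu_le_1)

text \<open>The kernel depends on its starting point only in a universally measurable way, so the
  source has to be a completion.\<close>

lemma mu_subprob_kernel:
  assumes M: "fin_borel M"
  shows "mu U \<in> completion M \<rightarrow>\<^sub>M subprob_algebra borel"
proof -
  have "(\<lambda>a. emeasure (mu U a) A) \<in> borel_measurable (completion M)" if "A \<in> sets borel" for A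
  proof -
    have "(\<lambda>a. measure (mu U a) A) \<in> borel_measurable (completion M)"
      using univ_meas_mu[OF that] M by (simp add: univ_meas_fun_def)
    from measurable_compose[OF this measurable_ennreal] show ?thesis by (simp add: emeasure_mu)
  qed
  from measurable_subprob_algebra[OF subprob_space_mu sets_mu this] show ?thesis .
qed

text \<open>Under the measure obtained from \<open>M\<close> by applying the kernel,
  \<open>f\<close> agrees with a Borel function off a Borel null set \<open>Z\<close>. Then
  \<open>Z\<close> is null for \<open>mu U y\<close> for almost every \<open>y\<close>, so
  \<open>f\<close> may be exchanged inside the inner integral too.\<close>

lemma
  fixes f :: "'a \<Rightarrow> ennreal"
  assumes f: "\<And>M. fin_borel M \<Longrightarrow> f \<in> borel_measurable (completion M)" and M: "fin_borel M"
  shows measurable_nn_integral_mu: "(\<lambda>y. \<integral>\<^sup>+z. f z \<partial>mu U y) \<in> borel_measurable (completion M)"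
    and nn_integral_bind_mu:
      "(\<integral>\<^sup>+z. f z \<partial>(completion M \<bind> mu U)) = (\<integral>\<^sup>+y. \<integral>\<^sup>+z. f z \<partial>mu U y \<partial>M)"
proof -
  interpret finite_measure M using M by (simp add: fin_borel_def)
  have sp: "space M = UNIV" by (rule space_fin_borel[OF M])
  let ?B = "completion M \<bind> mu U"
  note K = mu_subprob_kernel[OF M]
  have ne: "space (completion M) \<noteq> {}" by (simp add: sp)
  have sB: "sets ?B = sets borel" by (rule sets_bind_measurable[OF K ne])
  have spB: "space ?B = UNIV" using sets_eq_imp_space_eq[OF sB] by simp
  have eB: "emeasure ?B E = (\<integral>\<^sup>+x. emeasure (mu U x) E \<partial>M)" if "E \<in> sets borel" for E
    using emeasure_bind[OF ne K that] by (simp add: nn_integral_completion)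
  have "emeasure ?B UNIV \<le> (\<integral>\<^sup>+x. 1 \<partial>M)"
    by (subst eB, simp, intro nn_integral_mono) (simp add: emeasure_mu measure_mu_le_1)
  also have "\<dots> < \<infinity>" by (simp add: emeasure_eq_measure)
  finally have "finite_measure ?B" by (intro finite_measureI) (simp add: spB)
  then have B: "fin_borel ?B" using sB by (simp add: fin_borel_def)
  obtain f' where f': "f' \<in> borel_measurable ?B" and ae: "AE x in ?B. f x = f' x"
    using completion_ex_borel_measurable[OF f[OF B]] by blast
  have f'b: "f' \<in> borel_measurable borel" using f' sB measurable_cong_sets by blast
  from ae obtain Z where Z: "Z \<in> null_sets ?B" "{x \<in> space ?B. f x \<noteq> f' x} \<subseteq> Z"
    by (auto simp: eventually_ae_filter)
  have Zb: "Z \<in> sets borel" using Z sB by auto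
  have "(\<integral>\<^sup>+x. emeasure (mu U x) Z \<partial>completion M) = 0"
    using eB[OF Zb] Z by (simp add: nn_integral_completion null_setsD1)
  moreover have "(\<lambda>x. emeasure (mu U x) Z) \<in> borel_measurable (completion M)"
    using measurable_emeasure_kernel[OF K Zb] .
  ultimately have "AE x in completion M. emeasure (mu U x) Z = 0"
    by (simp add: nn_integral_0_iff_AE)
  then have eq: "AE y in completion M. (\<integral>\<^sup>+z. f z \<partial>mu U y) = (\<integral>\<^sup>+z. f' z \<partial>mu U y)"
  proof eventually_elim
    case (elim y)
    show ?case
      by (intro nn_integral_cong_AE AE_I'[of Z]) (use elim Z Zb spB in \<open>auto simp: null_sets_def sets_mu\<close>)
  qed
  have m: "(\<lambda>y. \<integral>\<^sup>+z. f' z \<partial>mu U y) \<in> borel_measurable (completion M)"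
    by (rule measurable_compose[OF K nn_integral_measurable_subprob_algebra[OF f'b]])
  show "(\<lambda>y. \<integral>\<^sup>+z. f z \<partial>mu U y) \<in> borel_measurable (completion M)"
    by (rule borel_measurable_completion_AE[OF m eq])
  have "(\<integral>\<^sup>+z. f z \<partial>?B) = (\<integral>\<^sup>+z. f' z \<partial>?B)" by (rule nn_integral_cong_AE[OF ae])
  also have "\<dots> = (\<integral>\<^sup>+y. \<integral>\<^sup>+z. f' z \<partial>mu U y \<partial>completion M)"
    by (rule nn_integral_bind[OF f'b K])
  also have "\<dots> = (\<integral>\<^sup>+y. \<integral>\<^sup>+z. f z \<partial>mu U y \<partial>completion M)"
    using eq by (intro nn_integral_cong_AE) (auto elim: eventually_mono)
  finally show "(\<integral>\<^sup>+z. f z \<partial>?B) = (\<integral>\<^sup>+y. \<integral>\<^sup>+z. f z \<partial>mu U y \<partial>M)"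
    by (simp add: nn_integral_completion)
qed

text \<open>The integrand in the sweeping axiom is bounded by 1 and the measure is finite, so the
  Bochner integral equals the nonnegative one.\<close>

lemma emeasure_mu_sweep:
  assumes V: "open V" "V \<subseteq> U" and E: "E \<in> sets borel"
  shows "emeasure (mu U x) E = (\<integral>\<^sup>+y. emeasure (mu U y) E \<partial>mu V x)"
proof -
  have fb: "fin_borel (mu V x)"
    using conjunct1[OF kernel[unfolded harmonic_kernel_def], rule_format, OF V(1), of x] by simp
  interpret finite_measure "completion (mu V x)"
  proof (rule finite_measureI)
    show "emeasure (completion (mu V x)) (space (completion (mu V x))) \<noteq> \<infinity>"
      using finite_measure.emeasure_finite[of "mu V x" UNIV] fb sets.top[of "mu V x"]
      by (simp add: fin_borel_def space_fin_borel[OF fb])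
  qed
  have m: "(\<lambda>y. measure (mu U y) E) \<in> borel_measurable (completion (mu V x))"
    using univ_meas_mu[OF E] fb by (simp add: univ_meas_fun_def)
  have "measure (mu U x) E = integral\<^sup>L (completion (mu V x)) (\<lambda>y. measure (mu U y) E)"
    using conjunct2[OF conjunct2[OF kernel[unfolded harmonic_kernel_def]], rule_format, OF U V E] .
  then have "emeasure (mu U x) E = ennreal (integral\<^sup>L (completion (mu V x)) (\<lambda>y. measure (mu U y) E))"
    by (simp add: emeasure_mu)
  also have "\<dots> = (\<integral>\<^sup>+y. ennreal (measure (mu U y) E) \<partial>completion (mu V x))"
    by (intro nn_integral_eq_integral[symmetric] integrable_const_bound[where B=1] m)
       (simp_all add: measure_mu_le_1)
  finally show ?thesis by (simp add: emeasure_mu nn_integral_completion)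
qed

end

text \<open>A path that leaves \<open>V\<close> by landing in \<open>E\<close> has left
  \<open>U\<close> as well. Formally, \<open>mu U y\<close> is the Dirac measure for
  \<open>y\<close> in \<open>E\<close>, so \<open>indicator E\<close> is at most
  \<open>mu U y E\<close>, and sweeping integrates this.\<close>

lemma mu_mono_outside:
  assumes "open U" "open V" "V \<subseteq> U" "E \<in> sets borel" "E \<inter> U = {}"
  shows "measure (mu V x) E \<le> measure (mu U x) E"
proof -
  have "emeasure (mu V x) E = (\<integral>\<^sup>+y. indicator E y \<partial>mu V x)"
    using assms by (simp add: sets_mu)
  also have "\<dots> \<le> (\<integral>\<^sup>+y. emeasure (mu U y) E \<partial>mu V x)"
  proof (intro nn_integral_mono)
    fix y
    show "indicator E y \<le> emeasure (mu U y) E"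
    proof (cases "y \<in> E")
      case True
      then have "y \<notin> U" using assms by blast
      then show ?thesis using True assms by (simp add: mu_outside)
    qed simp
  qed
  also have "\<dots> = emeasure (mu U x) E" using assms by (intro emeasure_mu_sweep[symmetric])
  finally show ?thesis using assms by (simp add: emeasure_mu)
qed

text \<open>Sweeping of sets says that composing \<open>mu V x\<close> with the kernel of
  \<open>U\<close> gives back \<open>mu U x\<close> as a measure; integrals follow.\<close>

lemma nn_integral_mu_sweep:
  fixes f :: "'a \<Rightarrow> ennreal"
  assumes U: "open U" and V: "open V" "V \<subseteq> U"
    and f: "\<And>M. fin_borel M \<Longrightarrow> f \<in> borel_measurable (completion M)"
  shows "(\<integral>\<^sup>+z. f z \<partial>mu U x) = (\<integral>\<^sup>+y. \<integral>\<^sup>+z. f z \<partial>mu U y \<partial>mu V x)"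
proof -
  have fb: "fin_borel (mu V x)" by (rule fin_borel_mu[OF V(1)])
  note K = mu_subprob_kernel[OF U fb]
  have ne: "space (completion (mu V x)) \<noteq> {}" by (simp add: space_mu[OF V(1)])
  have "completion (mu V x) \<bind> mu U = mu U x"
  proof (rule measure_eqI)
    show "sets (completion (mu V x) \<bind> mu U) = sets (mu U x)"
      using sets_bind_measurable[OF K ne] sets_mu[OF U] by simp
    fix E assume "E \<in> sets (completion (mu V x) \<bind> mu U)"
    then have E: "E \<in> sets borel" using sets_bind_measurable[OF K ne] by simp
    show "emeasure (completion (mu V x) \<bind> mu U) E = emeasure (mu U x) E"
      unfolding emeasure_bind[OF ne K E] using emeasure_mu_sweep[OF U V E, of x]
      by (simp add: nn_integral_completion)
  qed
  then show ?thesis using nn_integral_bind_mu[OF U f fb] by simp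
qed

end

section \<open>Hitting estimates\<close>

lemma closure_ball_subset_of_less_R0:
  assumes "ereal R < R0 X0 x"
  shows "closure (ball x R) \<subseteq> X0"
proof -
  obtain r where r: "ereal R < ereal r" "closure (ball x r) \<subseteq> X0"
    using assms unfolding R0_def less_Sup_iff by auto
  then have "closure (ball x R) \<subseteq> closure (ball x r)"
    by (intro closure_mono subset_ball) simp
  with r show ?thesis by blast
qed

lemma ereal_le_R0:
  assumes "0 < r" "closure (ball x r) \<subseteq> X0"
  shows "ereal r \<le> R0 X0 x"
  unfolding R0_def by (rule Sup_upper) (use assms in auto)

text \<open>The parameter \<open>aM\<close> is \<open>\<alpha>\<^sub>M = \<alpha>\<^sub>0 ^ k\<close>.\<close>

locale green_setting = harmonic_kernel_space mu
  for mu :: "'a::metric_space set \<Rightarrow> 'a \<Rightarrow> 'a measure" +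
  fixes G :: "'a \<Rightarrow> 'a \<Rightarrow> ennreal" and g :: "real \<Rightarrow> ennreal" and X0 :: "'a set"
    and c1 c cD M0 alpha0 c2 aM :: real
  assumes Gmeas: "(\<lambda>(x, y). G x y) \<in> borel_measurable (borel \<Otimes>\<^sub>M borel)"
    and hG1: "G1 mu G X0 c1"
    and hG2: "G2 G g c cD M0 alpha0"
    and hG3: "G3 G g X0 c2"
    and aM: "0 < aM" "aM < 1/4"
    and g_aM: "\<And>r. 0 < r \<Longrightarrow> ennreal (2 * cD\<^sup>2 * c\<^sup>2 * c1\<^sup>2) * g r \<le> g (aM * r)"
begin

section \<open>Real-valued form of the radial function \<open>g\<close>\<close>

definition gr :: "real \<Rightarrow> real" where
  "gr r = enn2real (g r)"

lemma consts_ge_1: "1 \<le> c" "1 \<le> cD" "1 \<le> c1" "1 \<le> c2"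
  using hG1 hG2 hG3 by (auto simp: G1_def G2_def G3_def)

lemma g_antimono: "0 \<le> r \<Longrightarrow> r \<le> s \<Longrightarrow> g s \<le> g r"
  using hG2 unfolding G2_def by (metis order.order_iff_strict)

lemma g_le_G: "g (dist x y) \<le> ennreal c * G x y"
  and G_le_g: "G x y \<le> ennreal c * g (dist x y)"
  using hG2 by (simp_all add: G2_def)

text \<open>Strict decrease makes \<open>g\<close> finite at positive radii. At 0 it may be
  infinite, and \<open>gr\<close> then takes the default value 0; hence the estimates for
  \<open>gr\<close> concern positive radii.\<close>

lemma ennreal_gr:
  assumes "0 < r"
  shows "ennreal (gr r) = g r"
proof -
  have "g r < g (r / 2)" using hG2 assms by (simp add: G2_def)
  then have "g r < \<top>" using top.not_eq_extremum by fastforce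
  then show ?thesis by (simp add: gr_def)
qed

lemma gr_pos: "0 < r \<Longrightarrow> 0 < gr r"
  using hG2 ennreal_gr[of r] by (metis G2_def ennreal_less_zero_iff less_imp_le)

lemma gr_antimono: "0 < r \<Longrightarrow> r \<le> s \<Longrightarrow> gr s \<le> gr r"
  using g_antimono[of r s] ennreal_gr[of r] ennreal_gr[of s] gr_pos[of r]
  by (metis ennreal_le_iff less_imp_le less_le_trans)

lemma gr_half: "0 < r \<Longrightarrow> gr (r / 2) \<le> cD * gr r"
proof -
  assume r: "0 < r"
  then have "g (r/2) \<le> ennreal cD * g r" using hG2 by (simp add: G2_def)
  then have "ennreal (gr (r/2)) \<le> ennreal (cD * gr r)"
    using r consts_ge_1 gr_pos[OF r] by (simp add: ennreal_gr ennreal_mult)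
  then show ?thesis using gr_pos[OF r] consts_ge_1 by (simp add: ennreal_le_iff)
qed

lemma gr_half_power: "0 < r \<Longrightarrow> gr (r / 2 ^ n) \<le> cD ^ n * gr r"
proof (induction n)
  case (Suc n)
  have "gr (r / 2 ^ Suc n) \<le> cD * gr (r / 2 ^ n)"
    using gr_half[of "r / 2 ^ n"] Suc.prems by (simp add: field_simps)
  also have "\<dots> \<le> cD * (cD ^ n * gr r)"
    using Suc consts_ge_1 by (intro mult_left_mono) auto
  finally show ?case by (simp add: mult.assoc)
qed simp

text \<open>Halving is iterated until the factor falls below \<open>q\<close>; the constant depends
  on \<open>q\<close> but not on the radius.\<close>

lemma gr_doubling:
  assumes "0 < q"
  shows "\<exists>C\<ge>1. \<forall>r>0. gr (q * r) \<le> C * gr r"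
proof -
  obtain n where n: "(1/2 :: real) ^ n < q" using real_arch_pow_inv[OF assms, of "1/2"] by auto
  have "gr (q * r) \<le> cD ^ n * gr r" if r: "0 < r" for r
  proof -
    have "r / 2 ^ n \<le> q * r" using n r by (simp add: field_simps power_divide)
    then have "gr (q * r) \<le> gr (r / 2 ^ n)" using r by (intro gr_antimono) auto
    also have "\<dots> \<le> cD ^ n * gr r" by (rule gr_half_power[OF r])
    finally show ?thesis .
  qed
  moreover have "1 \<le> cD ^ n" using consts_ge_1 by (intro one_le_power)
  ultimately show ?thesis by blast
qed

lemma gr_aM: "0 < r \<Longrightarrow> 2 * cD\<^sup>2 * c\<^sup>2 * c1\<^sup>2 * gr r \<le> gr (aM * r)"
proof -
  assume r: "0 < r"
  have "ennreal (2 * cD\<^sup>2 * c\<^sup>2 * c1\<^sup>2 * gr r) \<le> ennreal (gr (aM * r))"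
    using g_aM[OF r] r aM gr_pos[OF r] by (subst ennreal_mult) (simp_all add: ennreal_gr)
  then show ?thesis using gr_pos[of "aM * r"] r aM by (simp add: ennreal_le_iff)
qed

section \<open>From potentials to hitting probabilities\<close>

lemma measurable_G_section: "(\<lambda>y. G x y) \<in> borel_measurable borel"
  using measurable_compose[OF measurable_Pair1'[of x borel borel] Gmeas] by simp

text \<open>Duality: integrate \<open>pot G \<nu>\<close>, which is at least 1 on \<open>A\<close>,
  against \<sigma>, exchange the integrals and use \<open>pot G \<sigma> \<le> 1\<close>. Comparing
  \<open>G\<close> with a function of the distance makes it symmetric up to the factor
  \<open>c\<^sup>2\<close>.\<close>

lemma measure_le_equilibrium_mass:
  assumes \<sigma>: "fin_borel \<sigma>" "\<And>x. pot G \<sigma> x \<le> 1" and \<nu>: "fin_borel \<nu>"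
    and A: "A \<in> sets borel" "\<And>x. x \<in> A \<Longrightarrow> 1 \<le> pot G \<nu> x"
  shows "measure \<sigma> A \<le> c\<^sup>2 * measure \<nu> UNIV"
proof -
  interpret S: finite_measure \<sigma> using \<sigma> by (simp add: fin_borel_def)
  interpret N: finite_measure \<nu> using \<nu> by (simp add: fin_borel_def)
  interpret P: pair_sigma_finite \<sigma> \<nu> ..
  have sS: "sets \<sigma> = sets borel" and sN: "sets \<nu> = sets borel"
    using \<sigma> \<nu> by (simp_all add: fin_borel_def)
  have G_sym: "G x y \<le> ennreal (c\<^sup>2) * G y x" for x y
  proof -
    have "G x y \<le> ennreal c * g (dist y x)" using G_le_g[of x y] by (simp add: dist_commute)
    also have "\<dots> \<le> ennreal c * (ennreal c * G y x)" by (intro mult_left_mono g_le_G) auto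
    finally show ?thesis using consts_ge_1 by (simp add: ennreal_mult power2_eq_square mult.assoc)
  qed
  have "sets (\<sigma> \<Otimes>\<^sub>M \<nu>) = sets (borel \<Otimes>\<^sub>M borel)" by (rule sets_pair_measure_cong[OF sS sN])
  then have Gm: "(\<lambda>(x, y). G x y) \<in> borel_measurable (\<sigma> \<Otimes>\<^sub>M \<nu>)"
    using Gmeas measurable_cong_sets by blast
  have "emeasure \<sigma> A = (\<integral>\<^sup>+x. indicator A x \<partial>\<sigma>)" using A sS by simp
  also have "\<dots> \<le> (\<integral>\<^sup>+x. \<integral>\<^sup>+y. G x y \<partial>\<nu> \<partial>\<sigma>)"
    using A(2) by (intro nn_integral_mono) (auto simp: pot_def split: split_indicator)
  also have "\<dots> = (\<integral>\<^sup>+y. \<integral>\<^sup>+x. G x y \<partial>\<sigma> \<partial>\<nu>)" using P.Fubini'[OF Gm] by simp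
  also have "\<dots> \<le> (\<integral>\<^sup>+y. \<integral>\<^sup>+x. ennreal (c\<^sup>2) * G y x \<partial>\<sigma> \<partial>\<nu>)"
    by (intro nn_integral_mono G_sym)
  also have "\<dots> = (\<integral>\<^sup>+y. ennreal (c\<^sup>2) * pot G \<sigma> y \<partial>\<nu>)"
  proof -
    have "(\<lambda>x. G y x) \<in> borel_measurable \<sigma>" for y
      using measurable_G_section sS measurable_cong_sets by blast
    then show ?thesis unfolding pot_def by (simp add: nn_integral_cmult)
  qed
  also have "\<dots> \<le> (\<integral>\<^sup>+y. ennreal (c\<^sup>2) * 1 \<partial>\<nu>)"
    by (intro nn_integral_mono mult_left_mono \<sigma>(2)) auto
  also have "\<dots> = ennreal (c\<^sup>2 * measure \<nu> UNIV)"
    by (simp add: space_fin_borel[OF \<nu>] N.emeasure_eq_measure ennreal_mult)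
  finally show ?thesis by (simp add: S.emeasure_eq_measure)
qed

text \<open>(G1) yields a measure \<nu> near \<open>A\<close> whose potential is squeezed between
  the hitting probabilities of \<open>A\<close> and of a neighborhood \<open>B\<close>. This
  potential is far larger near \<open>A\<close> than outside \<open>ball x R\<close>, so hitting
  \<open>A\<close> only after leaving the ball cannot account for most of it.\<close>

lemma hitting_estimate:
  assumes R: "0 < R" "ereal R < R0 X0 x"
    and A: "closed A" "A \<subseteq> ball x (aM * R / 2)" and y: "y \<in> ball x (aM * R / 2)"
    and \<sigma>: "fin_borel \<sigma>" "\<And>x. pot G \<sigma> x \<le> 1"
  shows "gr R * measure \<sigma> A \<le> c\<^sup>2 * measure (mu (ball x R - A) y) A"
proof -
  let ?V = "ball x (aM * R / 2)" and ?U = "ball x R"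
  let ?W = "?U - A"
  let ?m = "measure (mu ?W y) A"
  let ?e = "\<lambda>A y. measure (mu (- A) y) UNIV"
  have VR: "aM * R / 2 \<le> R / 8" using aM R by (simp add: field_simps)
  have oW: "open ?W" using A by (simp add: open_Diff)
  have oA: "open (- A)" using A by (simp add: open_Compl)
  have "closure ?V \<subseteq> closure ?U" using VR R by (intro closure_mono subset_ball) linarith
  also have "\<dots> \<subseteq> X0" by (rule closure_ball_subset_of_less_R0[OF R(2)])
  finally have "closure ?V \<subseteq> X0" .
  then have V: "?V \<in> UX0 X0" by (simp add: UX0_def)
  have norm_eq: "mnorm (eps_bal mu B z) = ?e B z" if "closed B" for B z
    using that by (simp add: mnorm_def eps_bal_def space_mu open_Compl)
  \<comment> \<open>The slack \<delta> comes from replacing \<open>A\<close> by \<open>B\<close> in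
    (G1); it tends to 0 at the end.\<close>
  have main: "gr R * measure \<sigma> A \<le> c\<^sup>2 * (?m + \<delta>)" if \<delta>: "0 < \<delta>" for \<delta>
  proof -
    obtain B \<nu> where B: "closed B" "B \<subseteq> ?V" "fin_borel \<nu>" "emeasure \<nu> (- B) = 0"
        "mnorm (eps_bal mu B y) - \<delta> < c1 * mnorm (eps_bal mu A y)"
        "\<And>z. ennreal (mnorm (eps_bal mu A z)) \<le> pot G \<nu> z"
        "\<And>z. pot G \<nu> z \<le> ennreal (c1 * mnorm (eps_bal mu B z))"
      using conjunct2[OF hG1[unfolded G1_def], rule_format, OF V y \<delta> A] by blast
    interpret N: finite_measure \<nu> using B by (simp add: fin_borel_def)
    have sN: "sets \<nu> = sets borel" using B by (simp add: fin_borel_def)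
    let ?N = "measure \<nu> UNIV"
    have eN: "emeasure \<nu> (space \<nu>) = ennreal ?N"
      by (simp add: N.emeasure_eq_measure space_fin_borel[OF B(3)])
    have aeB: "AE w in \<nu>. w \<in> B"
      by (rule AE_I'[of "- B"]) (use B sN in \<open>auto simp: null_sets_def\<close>)
    have sig: "measure \<sigma> A \<le> c\<^sup>2 * ?N"
    proof (rule measure_le_equilibrium_mass[OF \<sigma> B(3)])
      fix z assume "z \<in> A"
      then have "mnorm (eps_bal mu A z) = 1"
        using A oA by (simp add: norm_eq mu_outside measure_def)
      then show "1 \<le> pot G \<nu> z" using B(6)[of z] by simp
    qed (use A in simp)
    let ?f = "c * cD * gr R * ?N"
    have f0: "0 \<le> ?f" using consts_ge_1 gr_pos[OF R(1)] by simp
    \<comment> \<open>As \<open>aM < 1/4\<close>, \<nu> lives within \<open>R / 8\<close> of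
      \<open>x\<close>, so points outside the ball have distance at least \<open>R / 2\<close> from
      it. One halving costs the factor \<open>cD\<close>.\<close>
    have far: "?e A z \<le> ?f" if z: "z \<notin> ?U" for z
    proof -
      have "pot G \<nu> z \<le> (\<integral>\<^sup>+w. ennreal (c * cD * gr R) \<partial>\<nu>)"
        unfolding pot_def
      proof (rule nn_integral_mono_AE, use aeB in eventually_elim)
        fix w assume "w \<in> B"
        then have "dist x w < aM * R / 2" using B(2) by auto
        then have "dist x w < R / 8" using VR by linarith
        moreover have "R \<le> dist x z" using z by auto
        ultimately have d: "R / 2 \<le> dist z w"
          using dist_triangle[of x z w] R dist_commute[of w z] by linarith
        have "G z w \<le> ennreal c * g (dist z w)" by (rule G_le_g)
        also have "\<dots> \<le> ennreal c * g (R / 2)"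
          using d R by (intro mult_left_mono g_antimono) auto
        also have "\<dots> = ennreal (c * gr (R / 2))"
          using R consts_ge_1 gr_pos[of "R/2"] by (simp add: ennreal_gr ennreal_mult)
        also have "\<dots> \<le> ennreal (c * cD * gr R)"
          using gr_half[OF R(1)] consts_ge_1 by (intro ennreal_leI) (simp add: mult.assoc)
        finally show "G z w \<le> ennreal (c * cD * gr R)" .
      qed
      also have "\<dots> = ennreal ?f"
        using consts_ge_1 gr_pos[OF R(1)] eN by (simp add: ennreal_mult)
      finally have "ennreal (?e A z) \<le> ennreal ?f"
        using B(6)[of z] A by (simp add: norm_eq)
      then show ?thesis using f0 by (simp add: ennreal_le_iff)
    qed
    \<comment> \<open>Both \<open>y\<close> and the carrier of \<nu> lie in a ball of radius
      \<open>aM * R / 2\<close>, so their distances are at most \<open>aM * R\<close>.\<close>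
    have near: "gr (aM * R) * ?N \<le> c * c1 * ?e B y"
    proof -
      have aR: "0 < aM * R" using aM R by simp
      have "ennreal (gr (aM * R) * ?N) = (\<integral>\<^sup>+w. g (aM * R) \<partial>\<nu>)"
        using eN aR gr_pos[OF aR] by (simp add: ennreal_mult ennreal_gr)
      also have "\<dots> \<le> (\<integral>\<^sup>+w. ennreal c * G y w \<partial>\<nu>)"
      proof (rule nn_integral_mono_AE, use aeB in eventually_elim)
        fix w assume "w \<in> B"
        then have "dist x w < aM * R / 2" "dist x y < aM * R / 2" using B(2) y by auto
        then have "dist y w \<le> aM * R"
          using dist_triangle[of y w x] dist_commute[of x y] by linarith
        then have "g (aM * R) \<le> g (dist y w)" by (intro g_antimono) auto
        also have "\<dots> \<le> ennreal c * G y w" by (rule g_le_G)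
        finally show "g (aM * R) \<le> ennreal c * G y w" .
      qed
      also have "\<dots> = ennreal c * pot G \<nu> y"
      proof -
        have "(\<lambda>w. G y w) \<in> borel_measurable \<nu>"
          using measurable_G_section sN measurable_cong_sets by blast
        then show ?thesis unfolding pot_def by (rule nn_integral_cmult)
      qed
      also have "\<dots> \<le> ennreal c * ennreal (c1 * ?e B y)"
        using B(7)[of y] B(1) by (intro mult_left_mono) (auto simp: norm_eq)
      also have "\<dots> = ennreal (c * c1 * ?e B y)"
        using consts_ge_1 by (simp add: ennreal_mult mult.assoc)
      finally show ?thesis using consts_ge_1 by (simp add: ennreal_le_iff)
    qed
    \<comment> \<open>Sweep from \<open>?W\<close>: a path ends in \<open>A\<close>, where at most 1
      is counted, or outside \<open>ball x R\<close>, where \<open>far\<close> applies.\<close>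
    have sw: "?e A y \<le> ?m + ?f"
    proof -
      have "ennreal (?e A y) = (\<integral>\<^sup>+z. ennreal (?e A z) \<partial>mu ?W y)"
        using emeasure_mu_sweep[OF oA oW, of UNIV y] by (simp add: emeasure_mu[OF oA] Diff_subset_conv)
      also have "\<dots> \<le> (\<integral>\<^sup>+z. indicator A z + ennreal ?f \<partial>mu ?W y)"
      proof (rule nn_integral_mono_AE, use AE_mu_notin[OF oW, of y] in eventually_elim)
        fix z assume z: "z \<notin> ?W"
        show "ennreal (?e A z) \<le> indicator A z + ennreal ?f"
        proof (cases "z \<in> A")
          case True
          then have "ennreal (?e A z) \<le> indicator A z" using measure_mu_le_1[OF oA] by simp
          then show ?thesis by (rule order_trans) (simp add: add_increasing2)
        next
          case False
          then show ?thesis using far[of z] z by (simp add: ennreal_leI)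
        qed
      qed
      also have "\<dots> = emeasure (mu ?W y) A + ennreal ?f * emeasure (mu ?W y) UNIV"
        using A
        by (subst nn_integral_add) (simp_all add: borel_measurable_indicator sets_mu[OF oW] space_mu[OF oW])
      also have "\<dots> \<le> ennreal ?m + ennreal ?f * 1"
        using measure_mu_le_1[OF oW, of y UNIV]
        by (intro add_mono mult_left_mono) (simp_all add: emeasure_mu[OF oW])
      also have "\<dots> = ennreal (?m + ?f)" using f0 by simp
      finally show ?thesis using f0 by (simp add: ennreal_le_iff del: ennreal_plus)
    qed
    let ?g = "gr R * ?N"
    have g0: "0 \<le> ?g" using gr_pos[OF R(1)] by simp
    have eB: "?e B y \<le> c1 * ?e A y + \<delta>" using B(5) A B(1) by (simp add: norm_eq)
    \<comment> \<open>This is where the constant in \<open>g_aM\<close> is used: the contribution of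
      \<open>far\<close> becomes at most half of the left side and is absorbed.\<close>
    have "2 * cD\<^sup>2 * c\<^sup>2 * c1\<^sup>2 * ?g \<le> gr (aM * R) * ?N"
      using mult_right_mono[OF gr_aM[OF R(1)], of ?N] by (simp add: mult.assoc)
    also have "\<dots> \<le> c * c1 * (c1 * (?m + ?f) + \<delta>)"
    proof -
      have "c1 * ?e A y \<le> c1 * (?m + ?f)" using sw consts_ge_1 by (intro mult_left_mono) auto
      then have "?e B y \<le> c1 * (?m + ?f) + \<delta>" using eB by linarith
      then have "c * c1 * ?e B y \<le> c * c1 * (c1 * (?m + ?f) + \<delta>)"
        using consts_ge_1 by (intro mult_left_mono) auto
      then show ?thesis using near by linarith
    qed
    also have "\<dots> \<le> c * c1 * (c1 * (?m + ?f) + c1 * \<delta>)"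
      using consts_ge_1 \<delta> by (intro mult_left_mono add_left_mono) auto
    also have "\<dots> = c * c1\<^sup>2 * (?m + \<delta>) + (c\<^sup>2 * c1\<^sup>2 * ?g) * cD"
      by (simp add: algebra_simps power2_eq_square)
    also have "\<dots> \<le> c * c1\<^sup>2 * (?m + \<delta>) + (c\<^sup>2 * c1\<^sup>2 * ?g) * cD\<^sup>2"
      using consts_ge_1 g0 by (intro add_left_mono mult_left_mono) (auto simp: power2_eq_square)
    finally have "cD\<^sup>2 * c\<^sup>2 * c1\<^sup>2 * ?g \<le> c * c1\<^sup>2 * (?m + \<delta>)"
      by (simp add: algebra_simps)
    moreover have "c * c1\<^sup>2 * ?g \<le> cD\<^sup>2 * c\<^sup>2 * c1\<^sup>2 * ?g"
    proof (intro mult_right_mono)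
      have "c * 1 \<le> c\<^sup>2 * cD\<^sup>2"
        using consts_ge_1 by (intro mult_mono) (auto simp: power2_eq_square mult_ge1_I)
      then show "c \<le> cD\<^sup>2 * c\<^sup>2" by (simp add: mult.commute)
    qed (use g0 in auto)
    ultimately have "(c * c1\<^sup>2) * ?g \<le> (c * c1\<^sup>2) * (?m + \<delta>)" by linarith
    then have "?g \<le> ?m + \<delta>" using consts_ge_1 by (subst (asm) mult_le_cancel_left_pos) auto
    have "gr R * measure \<sigma> A \<le> c\<^sup>2 * ?g"
      using mult_left_mono[OF sig, of "gr R"] gr_pos[OF R(1)] by (simp add: algebra_simps)
    also have "\<dots> \<le> c\<^sup>2 * (?m + \<delta>)" using \<open>?g \<le> ?m + \<delta>\<close> by (intro mult_left_mono) auto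
    finally show ?thesis .
  qed
  show ?thesis
  proof (rule field_le_epsilon)
    fix e :: real assume e: "0 < e"
    have c0: "0 < c\<^sup>2" using consts_ge_1 by auto
    show "gr R * measure \<sigma> A \<le> c\<^sup>2 * ?m + e"
      using main[of "e / c\<^sup>2"] e c0 by (simp add: distrib_left)
  qed
qed

end

context harmonic_kernel_space
begin

text \<open>In contrast to \<open>Harm\<close>, the mean value property is required for all open subsets of \<open>U\<close>,
  including \<open>U\<close> itself.\<close>

definition swept :: "('a \<Rightarrow> real) \<Rightarrow> 'a set \<Rightarrow> bool" where
  "swept u U \<longleftrightarrow> univ_meas_fun u \<and> (\<forall>y. 0 \<le> u y) \<and>
     (\<forall>W y. open W \<longrightarrow> W \<subseteq> U \<longrightarrow> (\<integral>\<^sup>+z. ennreal (u z) \<partial>mu W y) = ennreal (u y))"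

lemma swept_ennreal_measurable:
  "swept u U \<Longrightarrow> fin_borel M \<Longrightarrow> (\<lambda>z. ennreal (u z)) \<in> borel_measurable (completion M)"
  by (auto simp: swept_def univ_meas_fun_def)

lemma swept_nn_integral:
  "swept u U \<Longrightarrow> open W \<Longrightarrow> W \<subseteq> U \<Longrightarrow> (\<integral>\<^sup>+z. ennreal (u z) \<partial>mu W y) = ennreal (u y)"
  by (auto simp: swept_def)

lemma swept_nonneg: "swept u U \<Longrightarrow> 0 \<le> u y"
  by (simp add: swept_def)

end

section \<open>Level sets of swept functions and capacity\<close>

context green_setting
begin

text \<open>The mean value over \<open>ball x R - A\<close> counts at least \<open>t\<close> on
  \<open>A\<close>, and the mass of \<open>A\<close> there is bounded below by
  \<open>hitting_estimate\<close>. This domain reaches the boundary of the ball, which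
  \<open>swept\<close> permits.\<close>

lemma swept_lower_bound:
  assumes R: "0 < R" "ereal R < R0 X0 x" and u: "swept u (ball x R)"
    and A: "closed A" "A \<subseteq> ball x (aM * R / 2)" "\<And>w. w \<in> A \<Longrightarrow> t \<le> u w" and t: "0 \<le> t"
    and z: "z \<in> ball x (aM * R / 2)"
    and \<sigma>: "fin_borel \<sigma>" "\<And>x. pot G \<sigma> x \<le> 1"
  shows "t * (gr R * measure \<sigma> A) \<le> c\<^sup>2 * u z"
proof -
  let ?W = "ball x R - A"
  have oW: "open ?W" using A by (simp add: open_Diff)
  have "ennreal (t * measure (mu ?W z) A) = (\<integral>\<^sup>+w. ennreal t * indicator A w \<partial>mu ?W z)"
    using A(1) t by (simp add: nn_integral_cmult_indicator sets_mu[OF oW] ennreal_mult emeasure_mu[OF oW])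
  also have "\<dots> \<le> (\<integral>\<^sup>+w. ennreal (u w) \<partial>mu ?W z)"
    using A(3) by (intro nn_integral_mono) (auto intro: ennreal_leI split: split_indicator)
  also have "\<dots> = ennreal (u z)" by (rule swept_nn_integral[OF u oW]) auto
  finally have "t * measure (mu ?W z) A \<le> u z"
    using swept_nonneg[OF u] by (simp add: ennreal_le_iff)
  then have "c\<^sup>2 * (t * measure (mu ?W z) A) \<le> c\<^sup>2 * u z" by (intro mult_left_mono) auto
  moreover have "t * (gr R * measure \<sigma> A) \<le> t * (c\<^sup>2 * measure (mu ?W z) A)"
    by (intro mult_left_mono[OF hitting_estimate[OF R A(1,2) z \<sigma>] t])
  ultimately show ?thesis by (simp add: algebra_simps)
qed

text \<open>A measure \<sigma> nearly attaining the capacity of \<open>ball y s\<close> cannot put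
  much mass on points where \<open>u\<close> is at least \<open>t\<close>, since \<open>u z\<close>
  would then be too large. The constant 8 collects three factors 2: near attainment of the supremum,
  removal of the upper level set, and closed approximation.\<close>

lemma closed_sublevel_of_large_capacity:
  assumes R: "0 < R" "ereal R < R0 X0 x" and u: "swept u (ball x R)"
    and z: "z \<in> ball x (aM * R / 2)"
    and y: "y \<in> X0" and s: "0 < s" "ereal s < R0 X0 y" "ball y s \<subseteq> ball x (aM * R / 2)"
    and t: "0 < t" "4 * c2 * c\<^sup>2 * u z * gr s \<le> t * gr R"
  shows "\<exists>\<sigma> F. fin_borel \<sigma> \<and> (\<forall>x. pot G \<sigma> x \<le> 1) \<and> closed F \<and> F \<subseteq> ball y s \<and>
           (\<forall>w\<in>F. u w < t) \<and> 1 \<le> 8 * c2 * gr s * measure \<sigma> F"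
proof -
  \<comment> \<open>The lower bound for the capacity of \<open>ball y s\<close> from (G3).\<close>
  define b where "b = 1 / (c2 * gr s)"
  have pos: "0 < c2 * gr s" using gr_pos[OF s(1)] consts_ge_1 by simp
  then have b: "0 < b" by (simp add: b_def)
  have "inverse (ennreal c2 * g s) = ennreal b"
    using pos s(1) gr_pos[OF s(1)] consts_ge_1
    by (simp add: ennreal_gr[symmetric] ennreal_mult[symmetric] inverse_ennreal inverse_eq_divide b_def)
  then have "ennreal b \<le> cap G (ball y s)"
    using conjunct2[OF hG3[unfolded G3_def], rule_format, OF y s(1,2)] by simp
  moreover have "ennreal (b / 2) < ennreal b" using b by (simp add: ennreal_less_iff)
  ultimately have "ennreal (b / 2) < cap G (ball y s)" by (rule less_le_trans[rotated])
  then obtain \<sigma> where \<sigma>: "fin_borel \<sigma>" "emeasure \<sigma> (- ball y s) = 0" "\<And>x. pot G \<sigma> x \<le> 1"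
      and mass: "ennreal (b / 2) < emeasure \<sigma> (space \<sigma>)"
    unfolding cap_def less_SUP_iff by blast
  interpret finite_measure \<sigma> using \<sigma> by (simp add: fin_borel_def)
  have sets: "sets \<sigma> = sets borel" using \<sigma> by (simp add: fin_borel_def)
  have sp: "space \<sigma> = UNIV" by (rule space_fin_borel[OF \<sigma>(1)])
  let ?D = "completion \<sigma>" and ?B = "ball y s"
  have um: "u \<in> borel_measurable ?D"
    using u \<sigma>(1) by (simp add: swept_def univ_meas_fun_def)
  have BD: "?B \<in> sets ?D" using sets by simp
  have "{w \<in> space ?D. t \<le> u w} \<in> sets ?D" using um by measurable
  then have LD: "{w. t \<le> u w} \<in> sets ?D" using sp by simp
  let ?E = "?B \<inter> {w. t \<le> u w}" and ?E' = "?B - {w. t \<le> u w}"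
  have E: "?E \<in> sets ?D" "?E' \<in> sets ?D" using BD LD by auto
  have finD: "emeasure ?D X \<noteq> \<infinity>" if "X \<in> sets ?D" for X
    using that by simp
  have "b / 2 < measure \<sigma> UNIV" using mass sp b by (simp add: emeasure_eq_measure ennreal_less_iff)
  also have "measure \<sigma> UNIV = measure \<sigma> ?B"
  proof -
    have "measure \<sigma> (- ?B) = 0" using \<sigma>(2) by (simp add: measure_def)
    then show ?thesis
      using finite_measure_compl[of ?B] sets sp by (simp add: Compl_eq_Diff_UNIV)
  qed
  also have "\<dots> = measure ?D ?B" using sets by simp
  also have "?B = ?E \<union> ?E'" by auto
  also have "measure ?D \<dots> = measure ?D ?E + measure ?D ?E'"
    using E finD by (intro measure_Union) auto
  finally have sum: "b / 2 < measure ?D ?E + measure ?D ?E'" .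
  have "measure ?D ?E \<le> b / 4"
  proof (rule ccontr)
    assume "\<not> ?thesis"
    \<comment> \<open>The excess over \<open>b / 4\<close> is the approximation error, so the closed
      set \<open>F\<close> still has mass above \<open>b / 4\<close>.\<close>
    then have gap: "0 < measure ?D ?E - b / 4" by simp
    obtain F where F: "closed F" "F \<subseteq> ?E" "measure ?D ?E < measure \<sigma> F + (measure ?D ?E - b / 4)"
      using completion_closed_approx[OF \<sigma>(1) E(1) gap] by blast
    have "t * (gr R * measure \<sigma> F) \<le> c\<^sup>2 * u z"
      using F s(3) t by (intro swept_lower_bound[OF R u F(1) _ _ _ z \<sigma>(1,3)]) auto
    moreover have "t * (gr R * (b / 4)) < t * (gr R * measure \<sigma> F)"
      using F(3) t gr_pos[OF R(1)] by (intro mult_strict_left_mono) auto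
    ultimately have "t * (gr R * (b / 4)) < c\<^sup>2 * u z" by linarith
    then have "t * gr R < 4 * c2 * c\<^sup>2 * u z * gr s"
      using pos by (simp add: b_def field_simps)
    then show False using t by linarith
  qed
  then have "b / 4 < measure ?D ?E'" using sum by linarith
  moreover obtain F where F: "closed F" "F \<subseteq> ?E'" "measure ?D ?E' < measure \<sigma> F + b / 8"
    using completion_closed_approx[OF \<sigma>(1) E(2), of "b / 8"] b by auto
  ultimately have "b / 8 < measure \<sigma> F" by linarith
  then have "1 \<le> 8 * c2 * gr s * measure \<sigma> F" using pos by (simp add: b_def field_simps)
  then show ?thesis using \<sigma>(1,3) F(1,2) by (intro exI[of _ \<sigma>] exI[of _ F]) auto
qed

end

section \<open>Harnack inequality\<close>

locale harnack_setting = green_setting mu G g X0 c1 c cD M0 alpha0 c2 aM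
  for mu :: "'a::metric_space set \<Rightarrow> 'a \<Rightarrow> 'a measure" and G g X0 c1 c cD M0 alpha0 c2 aM +
  fixes alpha2 cJ :: real
  assumes hHJ: "HJ mu X0 alpha2 cJ"
begin

lemma alpha2: "0 < alpha2" "alpha2 < 1" and cJ: "1 \<le> cJ"
  using hHJ by (auto simp: HJ_def)

text \<open>If \<open>u\<close> stayed below \<open>1 + \<eta> / 4\<close> times \<open>u y\<close>
  on \<open>ball y r\<close>, the mean value at \<open>y\<close> would be smaller than
  \<open>u y\<close>. Here \<eta> bounds from below the probability of hitting a set where
  \<open>u\<close> is below \<open>\<kappa> * u y\<close>, and \<kappa> is such that this set and
  the long jumps together contribute at most \<open>\<eta> / 2\<close> times
  \<open>u y\<close>.\<close>

lemma growth_step: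
  assumes Cg: "1 \<le> Cg" "\<And>r. 0 < r \<Longrightarrow> gr (aM * alpha2 / 2 * r) \<le> Cg * gr r"
    and \<eta>: "\<eta> = 1 / (8 * c2 * c\<^sup>2 * Cg)" and \<kappa>: "\<kappa> = \<eta> / (2 * (1 + cJ))"
    and R: "0 < R" "ereal R < R0 X0 x" and u: "swept u (ball x R)"
    and z: "z \<in> ball x (aM * R / 2)"
    and y: "y \<in> X0" "0 < u y" and r: "0 < r" "ereal r < ereal alpha2 * R0 X0 y" "ball y r \<subseteq> ball x (aM * R / 2)"
    and large: "4 * c2 * c\<^sup>2 * u z * gr (aM * alpha2\<^sup>2 / 2 * r) \<le> \<kappa> * u y * gr R"
  shows "\<exists>w \<in> ball y r. (1 + \<eta> / 4) * u y \<le> u w"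
proof (rule ccontr)
  assume "\<not> ?thesis"
  then have small: "u w < (1 + \<eta> / 4) * u y" if "w \<in> ball y r" for w using that by force
  define t where "t = u y"
  \<comment> \<open>Leaving \<open>ball y r'\<close> and landing outside \<open>ball y r\<close> is
    the jump in (HJ). The radius \<open>s\<close> is small enough for
    \<open>hitting_estimate\<close> in \<open>ball y r'\<close>, and at most
    \<open>alpha2\<^sup>2 * r\<close>, so that points of \<open>F\<close> are admissible in
    (HJ).\<close>
  define s where "s = aM * alpha2\<^sup>2 / 2 * r"
  define r' where "r' = alpha2 * r"
  have pos: "0 < s" "0 < r'" "0 < t" using aM alpha2 r y by (simp_all add: s_def r'_def t_def)
  have \<eta>0: "0 < \<eta>" using \<eta> Cg consts_ge_1 by simp
  have \<kappa>0: "0 < \<kappa>" using \<kappa> \<eta>0 cJ by simp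
  have r'r: "r' < r" using alpha2 r by (simp add: r'_def)
  have a2: "alpha2\<^sup>2 < alpha2" using alpha2 by (simp add: power2_eq_square)
  have sr': "s \<le> aM * r' / 2"
    using mult_left_mono[OF less_imp_le[OF a2], of "aM * r"] aM r by (simp add: s_def r'_def field_simps)
  also have "\<dots> < r'" using aM pos by (simp add: field_simps)
  finally have s_less_r': "s < r'" .
  have s_a2: "s \<le> alpha2\<^sup>2 * r"
  proof -
    have "aM / 2 * (alpha2\<^sup>2 * r) \<le> 1 * (alpha2\<^sup>2 * r)" using aM r by (intro mult_right_mono) auto
    then show ?thesis by (simp add: s_def)
  qed
  have R0pos: "0 < R0 X0 y"
  proof (rule ccontr)
    assume "\<not> ?thesis"
    then have "ereal alpha2 * R0 X0 y \<le> 0" using alpha2 by (simp add: ereal_mult_le_0_iff)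
    then show False using r(1,2) by (metis ereal_less(2) less_le_trans not_less_iff_gr_or_eq)
  qed
  have r_R0: "ereal r < R0 X0 y"
  proof -
    have "ereal alpha2 * R0 X0 y \<le> 1 * R0 X0 y"
      using alpha2 R0pos by (intro ereal_mult_right_mono) auto
    then show ?thesis using r(2) by simp
  qed
  have r'_R0: "ereal r' < R0 X0 y" and s_R0: "ereal s < R0 X0 y"
    using r_R0 r'r s_less_r' by (meson ereal_less_le less_imp_le less_ereal.simps(1) less_trans)+
  have sub: "ball y s \<subseteq> ball x (aM * R / 2)"
    using r(3) s_less_r' r'r by (meson less_imp_le less_trans order_trans subset_ball)
  have "4 * c2 * c\<^sup>2 * u z * gr s \<le> (\<kappa> * t) * gr R" using large by (simp add: s_def t_def)
  then obtain \<sigma> F where F: "fin_borel \<sigma>" "\<And>x. pot G \<sigma> x \<le> 1" "closed F" "F \<subseteq> ball y s"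
      "\<And>w. w \<in> F \<Longrightarrow> u w < \<kappa> * t" "1 \<le> 8 * c2 * gr s * measure \<sigma> F"
    using closed_sublevel_of_large_capacity[OF R u z y(1) pos(1) s_R0 sub, of "\<kappa> * t"] \<kappa>0 pos by auto
  let ?W = "ball y r' - F"
  let ?m = "measure (mu ?W y) F"
  have oW: "open ?W" using F by (simp add: open_Diff)
  have Fr': "F \<subseteq> ball y (aM * r' / 2)" using F(4) sr' by (meson order_trans subset_ball)
  \<comment> \<open>\<open>s\<close> is \<open>aM * alpha2 / 2\<close> times \<open>r'\<close>, so
    \<open>Cg\<close> compares \<open>gr s\<close> with \<open>gr r'\<close>; the capacity bound for
    \<open>F\<close> then gives \<eta>.\<close>
  have m: "\<eta> \<le> ?m"
  proof -
    have "gr s \<le> Cg * gr r'"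
      using Cg(2)[OF pos(2)] by (simp add: s_def r'_def power2_eq_square mult.assoc)
    then have "8 * c2 * measure \<sigma> F * gr s \<le> 8 * c2 * measure \<sigma> F * (Cg * gr r')"
      using consts_ge_1 by (intro mult_left_mono) auto
    then have "1 \<le> 8 * c2 * Cg * (gr r' * measure \<sigma> F)" using F(6) by (simp add: algebra_simps)
    also have "\<dots> \<le> 8 * c2 * Cg * (c\<^sup>2 * ?m)"
      using consts_ge_1 Cg(1) aM pos
      by (intro mult_left_mono hitting_estimate[OF pos(2) r'_R0 F(3) Fr' _ F(1,2)]) auto
    finally show ?thesis using consts_ge_1 Cg(1) unfolding \<eta> by (simp add: field_simps)
  qed
  have m1: "?m \<le> 1" by (rule measure_mu_le_1[OF oW])
  obtain y' where y': "y' \<in> F"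
    using m \<eta>0 by (cases "F = {}") auto
  let ?O = "- ball y r" and ?S = "(1 + \<eta> / 4) * t"
  have S0: "0 \<le> ?S" using \<eta>0 pos by simp
  \<comment> \<open>Outside \<open>ball y r\<close> the exit law from \<open>y\<close> is dominated,
    up to \<open>cJ\<close>, by that of \<open>ball y r\<close> started at \<open>y'\<close> in
    \<open>F\<close>. The latter integrates \<open>u\<close> to \<open>u y'\<close>, which is below
    \<open>\<kappa> * t\<close>.\<close>
  have jump: "(\<integral>\<^sup>+w. ennreal (u w) * indicator ?O w \<partial>mu ?W y) \<le> ennreal (cJ * (\<kappa> * t))"
  proof -
    have "(\<integral>\<^sup>+w. ennreal (u w) * indicator ?O w \<partial>mu ?W y)
        \<le> ennreal cJ * (\<integral>\<^sup>+w. ennreal (u w) \<partial>mu (ball y r) y')"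
    proof (rule nn_integral_le_of_measure_le)
      fix E :: "'a set" assume E: "E \<in> sets borel" "E \<subseteq> ?O"
      have "measure (mu ?W y) E \<le> measure (mu (ball y r') y) E"
        using E r'r by (intro mu_mono_outside oW) (auto simp: subset_iff)
      also have "\<dots> \<le> cJ * measure (mu (ball y r) y') E"
        unfolding r'_def
      proof (rule conjunct2[OF conjunct2[OF conjunct2[OF hHJ[unfolded HJ_def]]], rule_format])
        show "y' \<in> ball y (alpha2\<^sup>2 * r)" using y' F(4) s_a2 by (meson subset_ball subset_iff)
      qed (use y r E in auto)
      finally show "measure (mu ?W y) E \<le> cJ * measure (mu (ball y r) y') E" .
    qed (use cJ swept_ennreal_measurable[OF u] in \<open>auto simp: fin_borel_mu oW\<close>)
    also have "(\<integral>\<^sup>+w. ennreal (u w) \<partial>mu (ball y r) y') = ennreal (u y')"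
    proof (rule swept_nn_integral[OF u])
      have "aM * R / 2 \<le> R" using aM R by (simp add: field_simps)
      then show "ball y r \<subseteq> ball x R" using r(3) by (meson order_trans subset_ball)
    qed simp
    also have "ennreal cJ * ennreal (u y') \<le> ennreal cJ * ennreal (\<kappa> * t)"
      using F(5)[OF y'] by (intro mult_left_mono ennreal_leI) auto
    also have "\<dots> = ennreal (cJ * (\<kappa> * t))" using cJ \<kappa>0 pos by (simp add: ennreal_mult)
    finally show ?thesis .
  qed
  let ?C = "completion (mu ?W y)"
  have [measurable]: "F \<in> sets ?C" "- F \<in> sets ?C" "?O \<in> sets ?C"
    using F(3) by (auto simp: sets_mu[OF oW] borel_closed closed_Compl open_Compl)
  have [measurable]: "(\<lambda>w. ennreal (u w)) \<in> borel_measurable ?C"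
    by (rule swept_ennreal_measurable[OF u fin_borel_mu[OF oW]])
  have "ennreal t = (\<integral>\<^sup>+w. ennreal (u w) \<partial>?C)"
  proof -
    have "aM * R / 2 \<le> R" using aM R by (simp add: field_simps)
    then have "?W \<subseteq> ball x R" using r(3) r'r by (meson Diff_subset less_imp_le order_trans subset_ball)
    from swept_nn_integral[OF u oW this, of y] show ?thesis
      by (simp add: nn_integral_completion t_def)
  qed
  \<comment> \<open>The constant \<open>?S\<close> is charged on all of \<open>- F\<close>, also
    outside \<open>ball y r\<close>, because only the bound \<open>1 - \<eta>\<close> for the mass
    of \<open>- F\<close> is available.\<close>
  also have "\<dots> \<le> (\<integral>\<^sup>+w. (ennreal (\<kappa> * t) * indicator F w + ennreal ?S * indicator (- F) w)
                     + ennreal (u w) * indicator ?O w \<partial>?C)"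
  proof (rule nn_integral_mono)
    fix w
    consider "w \<in> F" | "w \<notin> F" "w \<in> ball y r" | "w \<notin> F" "w \<notin> ball y r" by blast
    then show "ennreal (u w) \<le> (ennreal (\<kappa> * t) * indicator F w + ennreal ?S * indicator (- F) w)
                     + ennreal (u w) * indicator ?O w"
    proof cases
      case 1
      then have "ennreal (u w) \<le> ennreal (\<kappa> * t)" using F(5)[of w] by (intro ennreal_leI) simp
      with 1 show ?thesis by (simp add: add_increasing2)
    next
      case 2
      then have "ennreal (u w) \<le> ennreal ?S" using small[of w] by (intro ennreal_leI) (simp add: t_def)
      with 2 show ?thesis by (simp add: add_increasing2)
    next
      case 3
      then show ?thesis by (simp add: add_increasing)
    qed
  qed
  also have "\<dots> = (ennreal (\<kappa> * t) * emeasure ?C F + ennreal ?S * emeasure ?C (- F))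
      + (\<integral>\<^sup>+w. ennreal (u w) * indicator ?O w \<partial>?C)"
    by (simp add: nn_integral_add nn_integral_cmult_indicator del: emeasure_completion)
  also have "\<dots> = (ennreal (\<kappa> * t) * emeasure (mu ?W y) F + ennreal ?S * emeasure (mu ?W y) (- F))
      + (\<integral>\<^sup>+w. ennreal (u w) * indicator ?O w \<partial>mu ?W y)"
    using F(3) by (simp add: nn_integral_completion sets_mu[OF oW])
  also have "\<dots> \<le> (ennreal (\<kappa> * t) * ennreal 1 + ennreal ?S * ennreal (1 - \<eta>)) + ennreal (cJ * (\<kappa> * t))"
  proof (intro add_mono mult_left_mono jump)
    show "emeasure (mu ?W y) F \<le> ennreal 1" using m1 by (simp add: emeasure_mu[OF oW])
    have "measure (mu ?W y) (- F) = measure (mu ?W y) UNIV - ?m"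
      using finite_measure.finite_measure_compl[OF finite_measure_mu[OF oW], of F y] F(3)
      by (simp add: sets_mu[OF oW] space_mu[OF oW] Compl_eq_Diff_UNIV)
    then show "emeasure (mu ?W y) (- F) \<le> ennreal (1 - \<eta>)"
      unfolding emeasure_mu[OF oW] using m measure_mu_le_1[OF oW, of y UNIV] by (intro ennreal_leI) linarith
  qed auto
  also have "\<dots> = ennreal (\<kappa> * t + ?S * (1 - \<eta>) + cJ * (\<kappa> * t))"
    using \<kappa>0 pos S0 m m1 cJ by (simp add: ennreal_mult[symmetric] ennreal_plus[symmetric] del: ennreal_plus)
  finally have "t \<le> \<kappa> * t + ?S * (1 - \<eta>) + cJ * (\<kappa> * t)"
    using \<kappa>0 pos S0 m m1 cJ by (subst (asm) ennreal_le_iff) auto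
  \<comment> \<open>The loss \<eta> from \<open>F\<close> outweighs the gains
    \<open>\<eta> / 2\<close> and \<open>\<eta> / 4\<close>, so the right side is strictly below
    \<open>t\<close>.\<close>
  also have "\<dots> = t * (\<kappa> * (1 + cJ) + (1 + \<eta> / 4) * (1 - \<eta>))" by (simp add: algebra_simps)
  also have "\<kappa> * (1 + cJ) = \<eta> / 2" using cJ by (simp add: \<kappa> field_simps)
  also have "t * (\<eta> / 2 + (1 + \<eta> / 4) * (1 - \<eta>)) = t - t * (\<eta> / 4 + \<eta> * \<eta> / 4)"
    by (simp add: field_simps)
  finally have "t * (\<eta> / 4 + \<eta> * \<eta> / 4) \<le> 0" by linarith
  moreover have "0 < t * (\<eta> / 4 + \<eta> * \<eta> / 4)"
    using pos \<eta>0 by (intro mult_pos_pos add_pos_pos divide_pos_pos) auto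
  ultimately show False by linarith
qed

end

section \<open>Bounded approximation of harmonic functions\<close>

context harmonic_kernel_space
begin

text \<open>Sweep \<open>min h n\<close> on \<open>V\<close>. The result is at most \<open>n\<close>
  since the kernel has mass at most 1, and it has the mean value property by composition of kernels.
  Monotone convergence recovers \<open>h\<close> in \<open>V\<close> because the closure of
  \<open>V\<close> lies in \<open>D\<close>.\<close>

lemma swept_truncation:
  assumes h: "h \<in> Harm_pos mu D" and V: "open V" "closure V \<subseteq> D"
  shows "\<exists>u :: nat \<Rightarrow> 'a \<Rightarrow> real. (\<forall>n. swept (u n) V \<and> (\<forall>w. u n w \<le> real n)) \<and>
           (\<forall>y\<in>V. ennreal (h y) = (SUP n. ennreal (u n y)))"
proof -
  have hm: "univ_meas_fun h" and h0: "\<And>y. 0 \<le> h y"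
    and hint: "\<And>y. y \<in> V \<Longrightarrow> integrable (completion (mu V y)) h \<and> integral\<^sup>L (completion (mu V y)) h = h y"
    using h V by (auto simp: Harm_pos_def Harm_def)
  define f where "f n z = ennreal (min (h z) (real n))" for n :: nat and z
  have fm: "f n \<in> borel_measurable (completion M)" if "fin_borel M" for n M
  proof -
    have "h \<in> borel_measurable (completion M)" using hm that by (simp add: univ_meas_fun_def)
    then show ?thesis unfolding f_def by measurable
  qed
  define u where "u n y = enn2real (\<integral>\<^sup>+z. f n z \<partial>mu V y)" for n y
  have le: "(\<integral>\<^sup>+z. f n z \<partial>mu V y) \<le> ennreal (real n)" for n y
  proof -
    have "(\<integral>\<^sup>+z. f n z \<partial>mu V y) \<le> (\<integral>\<^sup>+z. ennreal (real n) \<partial>mu V y)"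
      unfolding f_def by (intro nn_integral_mono ennreal_leI) simp
    also have "\<dots> = ennreal (real n) * emeasure (mu V y) UNIV" by (simp add: space_mu[OF V(1)])
    also have "\<dots> \<le> ennreal (real n) * 1"
      using measure_mu_le_1[OF V(1)] by (intro mult_left_mono) (simp_all add: emeasure_mu[OF V(1)])
    finally show ?thesis by simp
  qed
  \<comment> \<open>The integral is at most \<open>n\<close>, so \<open>enn2real\<close> loses
    nothing.\<close>
  have eu: "ennreal (u n y) = (\<integral>\<^sup>+z. f n z \<partial>mu V y)" for n y
    unfolding u_def using le[where n=n and y=y] by (metis ennreal_enn2real ennreal_less_top le_less_trans)
  have "swept (u n) V" for n
    unfolding swept_def
  proof (intro conjI allI impI)
    show "univ_meas_fun (u n)"
      unfolding univ_meas_fun_def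
    proof (intro allI impI)
      fix M :: "'a measure" assume "fin_borel M"
      from measurable_nn_integral_mu[OF V(1) fm this, of n]
      show "u n \<in> borel_measurable (completion M)" unfolding u_def by measurable
    qed
    show "0 \<le> u n y" for y by (simp add: u_def)
    show "(\<integral>\<^sup>+z. ennreal (u n z) \<partial>mu W y) = ennreal (u n y)" if "open W" "W \<subseteq> V" for W y
      unfolding eu by (rule nn_integral_mu_sweep[OF V(1) that fm, symmetric])
  qed
  moreover have "u n w \<le> real n" for n w
    using le[where n=n and y=w] unfolding eu[symmetric] by (simp add: ennreal_le_iff)
  moreover have "ennreal (h y) = (SUP n. ennreal (u n y))" if y: "y \<in> V" for y
  proof -
    let ?C = "completion (mu V y)"
    have SUP_f: "(SUP n. f n z) = ennreal (h z)" for z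
    proof (rule antisym)
      show "(SUP n. f n z) \<le> ennreal (h z)" unfolding f_def by (intro SUP_least ennreal_leI) simp
      obtain n where "h z \<le> real n" using real_arch_simple by blast
      then have "f n z = ennreal (h z)" by (simp add: f_def)
      then show "ennreal (h z) \<le> (SUP n. f n z)" by (metis SUP_upper UNIV_I)
    qed
    have "ennreal (h y) = (\<integral>\<^sup>+z. ennreal (h z) \<partial>?C)"
      using hint[OF y] h0 by (subst nn_integral_eq_integral) auto
    also have "\<dots> = (\<integral>\<^sup>+z. (SUP n. f n z) \<partial>?C)" by (simp add: SUP_f)
    also have "\<dots> = (SUP n. \<integral>\<^sup>+z. f n z \<partial>?C)"
    proof (rule nn_integral_monotone_convergence_SUP)
      show "incseq f"
        unfolding f_def by (intro incseq_SucI le_funI ennreal_leI) auto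
    qed (rule fm[OF fin_borel_mu[OF V(1)]])
    finally show ?thesis by (simp add: eu nn_integral_completion)
  qed
  ultimately show ?thesis by blast
qed

end

section \<open>Iteration and passage to the limit\<close>

context harnack_setting
begin

text \<open>A violation of the inequality starts an iteration of \<open>growth_step\<close> that
  makes \<open>u\<close> exceed \<open>b\<close>. The constant \<open>K\<close> is fixed before
  \<open>u\<close> and \<open>b\<close>, which later allows an exhaustion by bounded
  functions.\<close>

lemma swept_harnack:
  assumes alpha: "0 < alpha" "alpha \<le> aM / 4" "alpha \<le> alpha2 / 4"
  shows "\<exists>K\<ge>1. \<forall>x R u b. 0 < R \<longrightarrow> ereal R < R0 X0 x \<longrightarrow> swept u (ball x R) \<longrightarrow> (\<forall>w. u w \<le> b) \<longrightarrow>
           (\<forall>y\<in>ball x (alpha * R). \<forall>z\<in>ball x (alpha * R). u y \<le> K * u z)"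
proof -
  obtain Cg where Cg: "1 \<le> Cg" "\<And>r. 0 < r \<Longrightarrow> gr (aM * alpha2 / 2 * r) \<le> Cg * gr r"
    using gr_doubling[of "aM * alpha2 / 2"] aM alpha2 by auto
  define \<eta> where \<eta>: "\<eta> = 1 / (8 * c2 * c\<^sup>2 * Cg)"
  define \<kappa> where \<kappa>: "\<kappa> = \<eta> / (2 * (1 + cJ))"
  have \<eta>0: "0 < \<eta>" using \<eta> Cg consts_ge_1 by simp
  have \<kappa>0: "0 < \<kappa>" using \<kappa> \<eta>0 cJ by simp
  define \<theta> where "\<theta> = 1 + \<eta> / 4"
  have \<theta>: "1 < \<theta>" using \<eta>0 by (simp add: \<theta>_def)
  \<comment> \<open>\<open>p\<close> steps at one radius must outgrow the factor \<open>cD\<close>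
    by which \<open>gr\<close> may increase when the radius is halved.\<close>
  obtain p where p: "cD < \<theta> ^ p" using real_arch_pow[OF \<theta>] by blast
  have p0: "0 < p" using p consts_ge_1 by (cases p) auto
  \<comment> \<open>\<open>q * R / 2 ^ j\<close> is the small radius
    \<open>aM * alpha2\<^sup>2 / 2 * r j\<close> that \<open>growth_step\<close> uses at radius
    \<open>r j\<close>.\<close>
  define q where "q = aM * alpha2\<^sup>2 / 2 * (alpha / (2 * real p))"
  have q0: "0 < q" using aM alpha2 alpha p0 by (simp add: q_def)
  obtain Cb where Cb: "1 \<le> Cb" "\<And>r. 0 < r \<Longrightarrow> gr (q * r) \<le> Cb * gr r"
    using gr_doubling[OF q0] by auto
  \<comment> \<open>Chosen so that \<open>K * u z < u y0\<close> implies the largeness hypothesis of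
    \<open>growth_step\<close> at every stage.\<close>
  define K where "K = max 1 (4 * c2 * c\<^sup>2 * Cb / \<kappa>)"
  have K1: "1 \<le> K" by (simp add: K_def)
  have K2: "4 * c2 * c\<^sup>2 * Cb \<le> \<kappa> * K"
  proof -
    have "4 * c2 * c\<^sup>2 * Cb / \<kappa> \<le> K" by (simp add: K_def)
    then show ?thesis using \<kappa>0 by (simp add: field_simps)
  qed
  have "u y0 \<le> K * u z"
    if R: "0 < R" "ereal R < R0 X0 x" and u: "swept u (ball x R)" and bdd: "\<forall>w. u w \<le> b"
      and y0: "y0 \<in> ball x (alpha * R)" and z: "z \<in> ball x (alpha * R)" for x R u b y0 z
  proof (rule ccontr)
    assume "\<not> ?thesis"
    then have less: "K * u z < u y0" by simp
    have u0: "0 < u y0" using less swept_nonneg[OF u, of z] K1 by (smt (verit) mult_nonneg_nonneg)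
    \<comment> \<open>The \<open>p\<close> steps of stage \<open>j\<close> move by less than
      \<open>alpha * R / 2 ^ (j + 1)\<close>. All stages together move by at most
      \<open>alpha * R\<close>, so the points stay in \<open>ball x (2 * alpha * R)\<close>.\<close>
    define r where "r j = alpha * R / (2 * real p) / 2 ^ j" for j :: nat
    have r0: "0 < r j" for j using alpha R p0 by (simp add: r_def)
    have aR: "alpha * R \<le> aM * R / 4" "alpha * R \<le> alpha2 * R / 4" "aM * R < R / 4"
      using mult_right_mono[OF alpha(2), of R] mult_right_mono[OF alpha(3), of R]
        mult_strict_right_mono[OF aM(2) R(1)] R by auto
    have zz: "z \<in> ball x (aM * R / 2)"
    proof -
      have "0 < aM * R" using aM R by simp
      then have "alpha * R \<le> aM * R / 2" using aR by linarith
      then show ?thesis using z by (meson subset_ball subset_iff)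
    qed
    have r_le: "r j \<le> alpha * R / 2" for j
    proof -
      have "1 * 1 \<le> real p * 2 ^ j" using p0 by (intro mult_mono) auto
      then have "alpha * R / 2 / (real p * 2 ^ j) \<le> alpha * R / 2 / 1"
        using alpha R by (intro divide_left_mono) auto
      then show ?thesis by (simp add: r_def mult.assoc)
    qed
    have step: "\<exists>v \<in> ball w (r j). \<theta> * u w \<le> u v"
      if w: "dist x w + r j \<le> 2 * alpha * R" "u y0 * cD ^ j \<le> u w" for w j
    proof -
      have uw: "0 < u w" using w(2) u0 consts_ge_1
        by (smt (verit) mult_pos_pos zero_less_power)
      \<comment> \<open>The bounds by quarters on \<open>alpha\<close> enter here:
        \<open>R0 X0 w\<close> is at least \<open>R / 2\<close>, which makes \<open>r j\<close>
        small enough for (HJ), and \<open>2 * alpha * R\<close> is at most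
        \<open>aM * R / 2\<close>.\<close>
      have wR: "dist x w < R / 2" using w(1) r0[of j] aR R by linarith
      have "w \<in> closure (ball x R)" using wR R by (intro subsetD[OF closure_subset]) auto
      then have wX: "w \<in> X0" using closure_ball_subset_of_less_R0[OF R(2)] by blast
      have "ball w (R / 2) \<subseteq> ball x R"
      proof
        fix v assume "v \<in> ball w (R / 2)"
        then show "v \<in> ball x R" using wR dist_triangle[of x v w] by auto
      qed
      then have "closure (ball w (R / 2)) \<subseteq> X0"
        using closure_ball_subset_of_less_R0[OF R(2)] closure_mono by blast
      then have "ereal (R / 2) \<le> R0 X0 w" using R by (intro ereal_le_R0) auto
      then have "ereal alpha2 * ereal (R / 2) \<le> ereal alpha2 * R0 X0 w"
        using alpha2 by (intro ereal_mult_left_mono) auto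
      moreover have "r j < alpha2 * (R / 2)"
      proof -
        have "0 < alpha2 * R" using alpha2 R by simp
        then show ?thesis using r_le[of j] aR by (simp add: field_simps)
      qed
      ultimately have rR0: "ereal (r j) < ereal alpha2 * R0 X0 w"
        by (metis less_ereal.simps(1) order_less_le_trans times_ereal.simps(1))
      have sub: "ball w (r j) \<subseteq> ball x (aM * R / 2)"
      proof
        fix v assume "v \<in> ball w (r j)"
        then show "v \<in> ball x (aM * R / 2)" using w(1) aR(1) dist_triangle[of x v w] by auto
      qed
      \<comment> \<open>After \<open>j\<close> halvings \<open>gr\<close> has grown by at most
        \<open>cD ^ j\<close>, which the assumed lower bound on \<open>u w\<close>
        compensates.\<close>
      have "gr (aM * alpha2\<^sup>2 / 2 * r j) = gr (q * R / 2 ^ j)"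
        by (simp add: r_def q_def field_simps)
      also have "\<dots> \<le> cD ^ j * gr (q * R)" using q0 R by (intro gr_half_power) simp
      also have "\<dots> \<le> cD ^ j * (Cb * gr R)"
        using consts_ge_1 Cb(2)[OF R(1)] by (intro mult_left_mono) auto
      finally have g_le: "gr (aM * alpha2\<^sup>2 / 2 * r j) \<le> cD ^ j * (Cb * gr R)" .
      have "4 * c2 * c\<^sup>2 * u z * gr (aM * alpha2\<^sup>2 / 2 * r j)
          \<le> 4 * c2 * c\<^sup>2 * u z * (cD ^ j * (Cb * gr R))"
        using g_le swept_nonneg[OF u] consts_ge_1 by (intro mult_left_mono) auto
      also have "\<dots> = (4 * c2 * c\<^sup>2 * Cb) * (u z * cD ^ j * gr R)" by (simp add: algebra_simps)
      also have "\<dots> \<le> (\<kappa> * K) * (u z * cD ^ j * gr R)"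
        using K2 swept_nonneg[OF u] consts_ge_1 gr_pos[OF R(1)] by (intro mult_right_mono) auto
      also have "\<dots> = \<kappa> * ((K * u z) * cD ^ j) * gr R" by (simp add: algebra_simps)
      also have "\<dots> \<le> \<kappa> * (u y0 * cD ^ j) * gr R"
        using less \<kappa>0 consts_ge_1 gr_pos[OF R(1)] by (intro mult_right_mono mult_left_mono) auto
      also have "\<dots> \<le> \<kappa> * u w * gr R"
        using w(2) \<kappa>0 gr_pos[OF R(1)] by (intro mult_right_mono mult_left_mono) auto
      finally show ?thesis
        unfolding \<theta>_def by (intro growth_step[OF Cg \<eta> \<kappa> R u zz wX uw r0 rR0 sub])
    qed
    \<comment> \<open>Up to \<open>p\<close> steps at the same radius; \<open>u\<close> never
      decreases along them, so the hypothesis of \<open>step\<close> persists.\<close>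
    have stage: "\<exists>v. dist x v < d + real i * r j \<and> \<theta> ^ i * u w \<le> u v"
      if w: "dist x w < d" "u y0 * cD ^ j \<le> u w" and d: "d + real p * r j \<le> 2 * alpha * R" and "i \<le> p"
      for w d i j
      using \<open>i \<le> p\<close>
    proof (induction i)
      case 0
      then show ?case using w by auto
    next
      case (Suc i)
      then obtain v where v: "dist x v < d + real i * r j" "\<theta> ^ i * u w \<le> u v" by auto
      have "real (Suc i) * r j \<le> real p * r j" using Suc.prems r0[of j] by (intro mult_right_mono) auto
      then have i: "d + real i * r j + r j \<le> 2 * alpha * R" using d by (simp add: algebra_simps)
      have "1 * u w \<le> \<theta> ^ i * u w"
        using \<theta> swept_nonneg[OF u] by (intro mult_right_mono one_le_power) auto
      then have "u y0 * cD ^ j \<le> u v" using v w by linarith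
      moreover have "dist x v + r j \<le> 2 * alpha * R" using v i by linarith
      ultimately obtain v' where v': "v' \<in> ball v (r j)" "\<theta> * u v \<le> u v'" using step by blast
      have "dist x v' < d + real (Suc i) * r j"
        using v v' dist_triangle[of x v' v] by (auto simp: algebra_simps)
      moreover have "\<theta> ^ Suc i * u w \<le> u v'"
      proof -
        have "\<theta> * (\<theta> ^ i * u w) \<le> \<theta> * u v" using v(2) \<theta> by (intro mult_left_mono) auto
        then show ?thesis using v'(2) by (simp add: mult.assoc)
      qed
      ultimately show ?case by blast
    qed
    have chain: "\<exists>w. dist x w < alpha * R * (2 - 1 / 2 ^ j) \<and> u y0 * (\<theta> ^ p) ^ j \<le> u w" for j
    proof (induction j)
      case 0
      then show ?case using y0 by auto
    next
      case (Suc j)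
      then obtain w where w: "dist x w < alpha * R * (2 - 1 / 2 ^ j)" "u y0 * (\<theta> ^ p) ^ j \<le> u w" by blast
      have "cD ^ j \<le> (\<theta> ^ p) ^ j" using p consts_ge_1 by (intro power_mono) auto
      then have "u y0 * cD ^ j \<le> u y0 * (\<theta> ^ p) ^ j" using u0 by (intro mult_left_mono) auto
      then have w2: "u y0 * cD ^ j \<le> u w" using w by linarith
      have eq: "alpha * R * (2 - 1 / 2 ^ j) + real p * r j = alpha * R * (2 - 1 / 2 ^ Suc j)"
        using p0 by (simp add: r_def field_simps)
      have "alpha * R * (2 - 1 / 2 ^ Suc j) \<le> alpha * R * 2"
        using alpha R by (intro mult_left_mono) auto
      then have "alpha * R * (2 - 1 / 2 ^ j) + real p * r j \<le> 2 * alpha * R" using eq by simp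
      from stage[OF w(1) w2 this order_refl] obtain v
        where v: "dist x v < alpha * R * (2 - 1 / 2 ^ Suc j)" "\<theta> ^ p * u w \<le> u v" using eq by auto
      have "u y0 * (\<theta> ^ p) ^ Suc j \<le> \<theta> ^ p * u w"
        using mult_left_mono[OF w(2), of "\<theta> ^ p"] \<theta> by (simp add: algebra_simps)
      with v show ?case by (intro exI[of _ v]) linarith
    qed
    have "1 < \<theta> ^ p" using p consts_ge_1 by linarith
    then obtain j where "b / u y0 < (\<theta> ^ p) ^ j" using real_arch_pow by blast
    then have "b < u y0 * (\<theta> ^ p) ^ j" using u0 by (simp add: field_simps)
    moreover obtain w where "u y0 * (\<theta> ^ p) ^ j \<le> u w" using chain by blast
    ultimately show False using bdd by (meson less_le_trans not_less)
  qed
  with K1 show ?thesis by blast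
qed

text \<open>Apply \<open>swept_harnack\<close> to the bounded approximations of \<open>h\<close> on
  a slightly smaller ball and let \<open>n\<close> tend to infinity; \<open>K\<close> does not
  depend on \<open>n\<close>.\<close>

lemma Harm_pos_harnack:
  assumes alpha: "0 < alpha" "alpha \<le> aM / 4" "alpha \<le> alpha2 / 4"
  shows "\<exists>K\<ge>1. \<forall>x R h. 0 < R \<longrightarrow> ereal R < R0 X0 x \<longrightarrow> h \<in> Harm_pos mu (ball x R) \<longrightarrow>
           (\<forall>y\<in>ball x (alpha * R). \<forall>z\<in>ball x (alpha * R). h y \<le> K * h z)"
proof -
  obtain K where K: "1 \<le> K" and harnack: "\<And>x R u b y z. 0 < R \<Longrightarrow> ereal R < R0 X0 x \<Longrightarrow>
      swept u (ball x R) \<Longrightarrow> (\<forall>w. u w \<le> b) \<Longrightarrow>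
      y \<in> ball x (alpha * R) \<Longrightarrow> z \<in> ball x (alpha * R) \<Longrightarrow> u y \<le> K * u z"
    using swept_harnack[OF alpha] by blast
  have "h y \<le> K * h z"
    if R: "0 < R" "ereal R < R0 X0 x" and h: "h \<in> Harm_pos mu (ball x R)"
      and y: "y \<in> ball x (alpha * R)" and z: "z \<in> ball x (alpha * R)" for x R h y z
  proof -
    have h0: "\<And>w. 0 \<le> h w" using h by (simp add: Harm_pos_def)
    \<comment> \<open>Strictness leaves room for a radius \<open>S < R\<close> with both points
      still in \<open>ball x (alpha * S)\<close>; the closure of \<open>ball x S\<close> then lies
      in \<open>ball x R\<close>, as the mean value property of \<open>h\<close> requires.\<close>
    have "max (dist x y) (dist x z) / alpha < R" using y z alpha by (simp add: field_simps)
    then obtain S where S: "max (dist x y) (dist x z) / alpha < S" "S < R" using dense by blast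
    then have yz: "y \<in> ball x (alpha * S)" "z \<in> ball x (alpha * S)"
      using alpha by (auto simp: field_simps)
    have "0 \<le> max (dist x y) (dist x z) / alpha" using alpha by (simp add: le_max_iff_disj)
    then have S0: "0 < S" using S by linarith
    have "alpha * S \<le> S" using alpha aM S0 by simp
    then have V: "y \<in> ball x S" "z \<in> ball x S" using yz by auto
    have "closure (ball x S) \<subseteq> cball x S" by (rule closure_minimal) auto
    then have "closure (ball x S) \<subseteq> ball x R" using S by auto
    from swept_truncation[OF h open_ball this] obtain u :: "nat \<Rightarrow> 'a \<Rightarrow> real"
      where u: "\<And>n. swept (u n) (ball x S)" "\<And>n. \<forall>w. u n w \<le> real n"
        "\<And>w. w \<in> ball x S \<Longrightarrow> ennreal (h w) = (SUP n. ennreal (u n w))" by blast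
    have SR: "ereal S < R0 X0 x" using S R by (meson less_ereal.simps(1) less_trans)
    have "ennreal (h y) = (SUP n. ennreal (u n y))" by (rule u(3)[OF V(1)])
    also have "\<dots> \<le> ennreal (K * h z)"
    proof (rule SUP_least)
      fix n
      have "ennreal (u n z) \<le> ennreal (h z)" unfolding u(3)[OF V(2)] by (rule SUP_upper) simp
      then have "u n z \<le> h z" using h0 by (simp add: ennreal_le_iff)
      then have "K * u n z \<le> K * h z" using K by (intro mult_left_mono) auto
      then show "ennreal (u n y) \<le> ennreal (K * h z)"
        using harnack[OF S0 SR u(1,2) yz, of n] by (intro ennreal_leI) linarith
    qed
    finally show ?thesis using h0 K by (simp add: ennreal_le_iff)
  qed
  with K show ?thesis by blast
qed

end

theorem theorem4p10:
  fixes mu :: "'a::metric_space set \<Rightarrow> 'a \<Rightarrow> 'a measure"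
    and G :: "'a \<Rightarrow> 'a \<Rightarrow> ennreal" and g :: "real \<Rightarrow> ennreal"
    and X0 :: "'a set"
    and c1 c cD M0 alpha0 c2 alpha2 cJ alpha :: real and k :: nat
  assumes sep: "separable_space (euclidean :: 'a topology)"
    and X0: "open X0"
    and kernel: "harmonic_kernel mu"
    and Gpos: "\<forall>x y. 0 < G x y"
    and Gmeas: "(\<lambda>(x, y). G x y) \<in> borel_measurable (borel \<Otimes>\<^sub>M borel)"
    and hG1: "G1 mu G X0 c1"
    and hG2: "G2 G g c cD M0 alpha0"
    and hG3: "G3 G g X0 c2"
    and hHJ: "HJ mu X0 alpha2 cJ"
    and hk1: "max (2 * cD\<^sup>2 * c\<^sup>2 * c1\<^sup>2) (3 * c * c2) \<le> M0 ^ k"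
    and hk2: "alpha0 ^ k < 1/4"
    and halpha: "0 < alpha" "alpha \<le> min (alpha0 ^ k) alpha2 / 4"
  shows "\<exists>K \<ge> 1. \<forall>x \<in> X0. \<forall>R. 0 < R \<longrightarrow> ereal R < R0 X0 x \<longrightarrow>
           (\<forall>h \<in> Harm_pos mu (ball x R).
              (SUP y \<in> ball x (alpha * R). ereal (h y))
                \<le> ereal K * (INF y \<in> ball x (alpha * R). ereal (h y)))"
proof -
  have a0: "0 < alpha0" and M0: "1 \<le> M0"
    and g_step: "\<And>r. 0 < r \<Longrightarrow> ennreal M0 * g r \<le> g (alpha0 * r)"
    using hG2 by (simp_all add: G2_def)
  \<comment> \<open>Iterating the growth condition of (G2) turns \<open>M0 ^ k\<close> into the
    constant that \<open>g_aM\<close> demands at \<open>alpha0 ^ k\<close>.\<close>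
  have g_pow: "ennreal (M0 ^ n) * g r \<le> g (alpha0 ^ n * r)" if r: "0 < r" for n r
  proof (induction n)
    case (Suc n)
    have "ennreal (M0 ^ Suc n) * g r = ennreal M0 * (ennreal (M0 ^ n) * g r)"
      using M0 by (simp add: ennreal_mult mult.assoc)
    also have "\<dots> \<le> ennreal M0 * g (alpha0 ^ n * r)" using Suc by (intro mult_left_mono) auto
    also have "\<dots> \<le> g (alpha0 * (alpha0 ^ n * r))" using a0 r by (intro g_step) simp
    finally show ?case by (simp add: mult.assoc)
  qed simp
  interpret harnack_setting mu G g X0 c1 c cD M0 alpha0 c2 "alpha0 ^ k" alpha2 cJ
  proof unfold_locales
    show "ennreal (2 * cD\<^sup>2 * c\<^sup>2 * c1\<^sup>2) * g r \<le> g (alpha0 ^ k * r)" if "0 < r" for r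
      using hk1 by (intro order_trans[OF mult_right_mono g_pow[OF that, of k]] ennreal_leI) auto
  qed (use kernel Gmeas hG1 hG2 hG3 hHJ hk2 a0 in auto)
  obtain K where K: "1 \<le> K" and harnack: "\<And>x R h y z. 0 < R \<Longrightarrow> ereal R < R0 X0 x \<Longrightarrow>
      h \<in> Harm_pos mu (ball x R) \<Longrightarrow>
      y \<in> ball x (alpha * R) \<Longrightarrow> z \<in> ball x (alpha * R) \<Longrightarrow> h y \<le> K * h z"
    using Harm_pos_harnack[of alpha] halpha by auto
  show ?thesis
  proof (intro exI[of _ K] conjI ballI allI impI)
    fix x R h
    assume R: "0 < R" "ereal R < R0 X0 x" and h: "h \<in> Harm_pos mu (ball x R)"
    let ?B = "ball x (alpha * R)"
    \<comment> \<open>Dividing by \<open>K\<close> leaves the infimum alone on the right, so it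
      suffices to compare with each single value \<open>h z\<close>.\<close>
    have "(SUP y \<in> ?B. ereal (h y)) / ereal K \<le> (INF y \<in> ?B. ereal (h y))"
    proof (rule INF_greatest)
      fix z assume z: "z \<in> ?B"
      have "(SUP y \<in> ?B. ereal (h y)) \<le> ereal (h z) * ereal K"
        using harnack[OF R h _ z] by (intro SUP_least) (simp add: mult.commute)
      then show "(SUP y \<in> ?B. ereal (h y)) / ereal K \<le> ereal (h z)"
        using K by (subst ereal_divide_le_pos) (auto simp: mult.commute)
    qed
    then show "(SUP y \<in> ?B. ereal (h y)) \<le> ereal K * (INF y \<in> ?B. ereal (h y))"
      using K by (subst (asm) ereal_divide_le_pos) (auto simp: mult.commute)
  qed (fact K)
qed

end
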